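(* Under the standing assumptions on $G_n$, $\mathcal S$ and the weights given in the context, let $\beta\in[0,\infty)$, let $\gamma=\lim_{n\to\infty}m^2/(2|E_n|)$, and let $\pi$ and $\pi'$ be two independent samples (given $\boldsymbol\omega$) from the Gibbs measure $\mathbb P_{\beta,\boldsymbol\omega}$. Then, as $n\to\infty$, the number $|\pi\cap\pi'|$ of common edges converges to $\mathrm{Poisson}\left(2\gamma\cdot e^{\psi(2\beta)-2\psi(\beta)}\right)$ in probability; that is, the (random) law of $|\pi\cap\pi'|$ under $\mathbb P_{\beta,\boldsymbol\omega}\otimes\mathbb P_{\beta,\boldsymbol\omega}$ converges weakly to $\mathrm{Poisson}\left(2\gamma\cdot e^{\psi(2\beta)-2\psi(\beta)}\right)$, in probability with respect to $\boldsymbol\omega$.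
   Context: Graphs: $G_n=(V_n,E_n)$, $n\in\mathbb N$, is a sequence of finite undirected edge-transitive graphs with $|V_n|=c\cdot n$ for some fixed $c\in\mathbb N$ and $|E_n|=\Theta(|V_n|^2)$. Weights: $\boldsymbol\omega=\{\omega_e\}_{e\in E_n}$ are i.i.d. with a law not depending on $n$ and such that $\psi(\beta):=\log\mathbb E e^{-\beta\omega_e}<\infty$ for all $\beta\in[0,\infty)$. Weights may equal $+\infty$ with positive probability (but not almost surely), with the convention $e^{-\beta\cdot(+\infty)}=0$ for every $\beta\ge0$. Optimization problem: $\mathcal S=\mathcal S(n)$ is a nonempty collection of spanning subgraphs of $G_n$, identified with their edge sets; $\widetilde{\mathcal S}$ is the collection of all subsets of elements of $\mathcal S$. A partial matching is a set of pairwise vertex-disjoint edges. $\mathbb P_0$ denotes the law of $\pi$ uniform on $\mathcal S$. It is assumed that: (1) all elements of $\mathcal S$ have the same number of edges $m=m(n)$, and $\lim_{n\to\infty} m^2/(2|E_n|)=\gamma\in(0,\infty)$; (2) for every partial matching $\Gamma\subseteq E_n$ there is $\pi\in\mathcal S$ with $\Gamma\subseteq\pi$; (3) there is a constant $\rho\in(0,\infty)$ (independent of $n$) such that for every $k\in\mathbb N$ and every partial matching $\Gamma$ with $k$ edges, $\left|\frac{\mathbb P_0(\Gamma\subseteq\pi)}{\prod_{e\in\Gamma}\mathbb P_0(e\in\pi)}-1\right|\le \frac{\rho^k}{\sqrt m}$; (4) there is a constant $\rho\in(0,\infty)$ (independent of $n$) such that for every $k\in\mathbb N$ and every $\Gamma\in\widetilde{\mathcal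 S}$ with $k$ edges that is not a partial matching, $\mathbb P_0(\Gamma\subseteq\pi)\le\rho^k\prod_{e\in\Gamma}\mathbb P_0(e\in\pi)$. Moreover $\mathbb P_0(e\in\pi)=p:=m/|E_n|$ for every $e\in E_n$. Gibbs measure: $W(\pi)=\sum_{e\in\pi}\omega_e$, $Z(\beta,\boldsymbol\omega)=\frac1{|\mathcal S|}\sum_{\pi\in\mathcal S}e^{-\beta W(\pi)}$, $\mathbb P_{\beta,\boldsymbol\omega}(\pi)=\frac{1}{Z(\beta,\boldsymbol\omega)|\mathcal S|}e^{-\beta W(\pi)}$ for $\pi\in\mathcal S$ (uniform if $Z=0$). *)

theory Defs
  imports "HOL-Probability.Probability" "HOL-Library.Landau_Symbols"
begin

section \<open>Graphs\<close>

text \<open>A simple graph is given by its vertex set and a set of two-element sets of vertices.\<close>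

definition finite_graph :: "'v set \<Rightarrow> 'v set set \<Rightarrow> bool" where
  "finite_graph V E \<longleftrightarrow> finite V \<and> E \<subseteq> {e. e \<subseteq> V \<and> card e = 2}"

definition graph_automorphism :: "'v set \<Rightarrow> 'v set set \<Rightarrow> ('v \<Rightarrow> 'v) \<Rightarrow> bool" where
  "graph_automorphism V E \<phi> \<longleftrightarrow>
     bij_betw \<phi> V V \<and> (\<forall>u\<in>V. \<forall>v\<in>V. {\<phi> u, \<phi> v} \<in> E \<longleftrightarrow> {u, v} \<in> E)"

definition edge_transitive :: "'v set \<Rightarrow> 'v set set \<Rightarrow> bool" where
  "edge_transitive V E \<longleftrightarrow>
     (\<forall>e\<in>E. \<forall>f\<in>E. \<exists>\<phi>. graph_automorphism V E \<phi> \<and> \<phi> ` e = f)"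

definition partial_matching :: "'v set set \<Rightarrow> 'v set set \<Rightarrow> bool" where
  "partial_matching E \<Gamma> \<longleftrightarrow> \<Gamma> \<subseteq> E \<and> pairwise disjnt \<Gamma>"


section \<open>The optimization problem\<close>

abbreviation prob_contains :: "'e set set \<Rightarrow> 'e set \<Rightarrow> real" where
  "prob_contains S \<Gamma> \<equiv> measure_pmf.prob (pmf_of_set S) {\<pi>. \<Gamma> \<subseteq> \<pi>}"

text \<open>
  A spanning subgraph has the full vertex set and is identified with its set of edges, so
  \<open>S n\<close> is a collection of subsets of \<open>E n\<close>. All conditions are imposed for \<open>n \<ge> 1\<close> only.
\<close>

locale optimization_problem =
  fixes V :: "nat \<Rightarrow> 'v set" and E :: "nat \<Rightarrow> 'v set set" and S :: "nat \<Rightarrow> 'v set set set"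
    and m :: "nat \<Rightarrow> nat" and \<gamma> :: real
  assumes graph: "\<And>n. n \<ge> 1 \<Longrightarrow> finite_graph (V n) (E n)"
    and edge_transitive: "\<And>n. n \<ge> 1 \<Longrightarrow> edge_transitive (V n) (E n)"
    and card_vertices: "\<exists>c::nat. \<forall>n\<ge>1. card (V n) = c * n"
    and card_edges: "(\<lambda>n. real (card (E n))) \<in> \<Theta>(\<lambda>n. real (card (V n)) ^ 2)"
    and nonempty: "\<And>n. n \<ge> 1 \<Longrightarrow> S n \<noteq> {}"
    and subgraphs: "\<And>n \<pi>. n \<ge> 1 \<Longrightarrow> \<pi> \<in> S n \<Longrightarrow> \<pi> \<subseteq> E n"
    and card_subgraph: "\<And>n \<pi>. n \<ge> 1 \<Longrightarrow> \<pi> \<in> S n \<Longrightarrow> card \<pi> = m n"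
    and gamma_pos: "\<gamma> > 0"
    and gamma_lim: "(\<lambda>n. real (m n) ^ 2 / (2 * real (card (E n)))) \<longlonglongrightarrow> \<gamma>"
    and matching_extends:
      "\<And>n \<Gamma>. n \<ge> 1 \<Longrightarrow> partial_matching (E n) \<Gamma> \<Longrightarrow> \<exists>\<pi>\<in>S n. \<Gamma> \<subseteq> \<pi>"
    and matching_quasi_independent:
      "\<exists>\<rho>>0. \<forall>n\<ge>1. \<forall>\<Gamma>. partial_matching (E n) \<Gamma> \<longrightarrow>
         \<bar>prob_contains (S n) \<Gamma> / (\<Prod>e\<in>\<Gamma>. prob_contains (S n) {e}) - 1\<bar>
           \<le> \<rho> ^ card \<Gamma> / sqrt (real (m n))"
    and nonmatching_bound:
      "\<exists>\<rho>>0. \<forall>n\<ge>1. \<forall>\<Gamma>. (\<exists>\<pi>\<in>S n. \<Gamma> \<subseteq> \<pi>) \<and> \<not> partial_matching (E n) \<Gamma> \<longrightarrow>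
         prob_contains (S n) \<Gamma> \<le> \<rho> ^ card \<Gamma> * (\<Prod>e\<in>\<Gamma>. prob_contains (S n) {e})"
    and edge_prob:
      "\<And>n e. n \<ge> 1 \<Longrightarrow> e \<in> E n \<Longrightarrow> prob_contains (S n) {e} = real (m n) / real (card (E n))"


section \<open>Weights\<close>

text \<open>
  \<open>exp (- \<beta> x)\<close> for \<open>x \<in> (-\<infinity>, \<infinity>]\<close>, with value \<open>0\<close> at \<open>x = \<infinity>\<close> even if \<open>\<beta> = 0\<close>.
  The value at \<open>-\<infinity>\<close> is junk; weights avoid \<open>-\<infinity>\<close> almost surely.
\<close>

definition boltzmann :: "real \<Rightarrow> ereal \<Rightarrow> real" where
  "boltzmann \<beta> x = (if x = \<infinity> then 0 else exp (- \<beta> * real_of_ereal x))"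

definition log_laplace :: "ereal measure \<Rightarrow> real \<Rightarrow> real" where
  "log_laplace \<mu> \<beta> = ln (\<integral>x. boltzmann \<beta> x \<partial>\<mu>)"

text \<open>
  The common law \<open>\<mu>\<close> does not depend on \<open>n\<close>, whereas the probability space \<open>M n\<close> carrying the
  weights \<open>\<omega> n\<close> may. As \<open>boltzmann \<beta>\<close> is nonnegative and measurable, integrability says that
  the log-Laplace transform of \<open>\<mu>\<close> is finite at \<open>\<beta>\<close>.
\<close>

locale iid_weights =
  fixes E :: "nat \<Rightarrow> 'e set" and \<mu> :: "ereal measure" and M :: "nat \<Rightarrow> 'w measure"
    and \<omega> :: "nat \<Rightarrow> 'e \<Rightarrow> 'w \<Rightarrow> ereal"
  assumes law: "prob_space \<mu>" "sets \<mu> = sets borel"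
    and not_minus_infinity: "AE x in \<mu>. x \<noteq> - \<infinity>"
    and not_as_infinity: "\<not> (AE x in \<mu>. x = \<infinity>)"
    and laplace_finite: "\<And>\<beta>. \<beta> \<ge> 0 \<Longrightarrow> integrable \<mu> (boltzmann \<beta>)"
    and prob: "\<And>n. n \<ge> 1 \<Longrightarrow> prob_space (M n)"
    and indep: "\<And>n. n \<ge> 1 \<Longrightarrow> prob_space.indep_vars (M n) (\<lambda>_. borel) (\<omega> n) (E n)"
    and ident: "\<And>n e. n \<ge> 1 \<Longrightarrow> e \<in> E n \<Longrightarrow> distr (M n) borel (\<omega> n e) = \<mu>"


section \<open>The Gibbs measure\<close>

definition total_weight :: "('e \<Rightarrow> ereal) \<Rightarrow> 'e set \<Rightarrow> ereal" where
  "total_weight w \<pi> = (\<Sum>e\<in>\<pi>. w e)"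

definition partition_function :: "'e set set \<Rightarrow> real \<Rightarrow> ('e \<Rightarrow> ereal) \<Rightarrow> real" where
  "partition_function S \<beta> w = (\<Sum>\<pi>\<in>S. boltzmann \<beta> (total_weight w \<pi>)) / real (card S)"

definition gibbs :: "'e set set \<Rightarrow> real \<Rightarrow> ('e \<Rightarrow> ereal) \<Rightarrow> 'e set pmf" where
  "gibbs S \<beta> w =
     (if partition_function S \<beta> w = 0 then pmf_of_set S
      else embed_pmf (\<lambda>\<pi>. if \<pi> \<in> S
             then boltzmann \<beta> (total_weight w \<pi>) / (partition_function S \<beta> w * real (card S))
             else 0))"

lemma pmf_gibbs:
  assumes "finite S" "S \<noteq> {}"
  shows "pmf (gibbs S \<beta> w) \<pi> =
     (if \<pi> \<in> S
      then if partition_function S \<beta> w = 0 then 1 / real (card S)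
           else boltzmann \<beta> (total_weight w \<pi>) / (partition_function S \<beta> w * real (card S))
      else 0)"
proof (cases "partition_function S \<beta> w = 0")
  case True
  then show ?thesis using assms by (simp add: gibbs_def)
next
  case False
  let ?Z = "partition_function S \<beta> w * real (card S)"
  let ?b = "\<lambda>\<pi>. boltzmann \<beta> (total_weight w \<pi>)"
  let ?f = "\<lambda>\<pi>. if \<pi> \<in> S then ?b \<pi> / ?Z else 0"
  have b: "?b \<pi> \<ge> 0" for \<pi> by (simp add: boltzmann_def)
  have Z: "?Z = (\<Sum>\<pi>\<in>S. ?b \<pi>)" using assms by (simp add: partition_function_def)
  have nn: "?f \<pi> \<ge> 0" for \<pi> unfolding Z by (simp add: b sum_nonneg)
  have "?Z \<noteq> 0" using False assms by simp
  then have "(\<Sum>\<pi>\<in>S. ?f \<pi>) = 1"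
    by (simp add: sum_divide_distrib[symmetric] Z[symmetric])
  then have "(\<Sum>\<pi>\<in>S. ennreal (?f \<pi>)) = 1"
    using sum_ennreal[of S ?f, OF nn] by (simp only: ennreal_1)
  moreover have "(\<integral>\<^sup>+ \<pi>. ennreal (?f \<pi>) \<partial>count_space UNIV) = (\<Sum>\<pi>\<in>S. ennreal (?f \<pi>))"
    using assms(1) by (intro nn_integral_count_space') auto
  ultimately have "(\<integral>\<^sup>+ \<pi>. ennreal (?f \<pi>) \<partial>count_space UNIV) = 1" by simp
  then have "pmf (embed_pmf ?f) \<pi> = ?f \<pi>" using nn by (intro pmf_embed_pmf)
  then show ?thesis using False by (simp add: gibbs_def)
qed

text \<open>The law of the number of common edges of two independent samples, given the weights.\<close>

definition overlap_law :: "'e set set \<Rightarrow> real \<Rightarrow> ('e \<Rightarrow> ereal) \<Rightarrow> nat pmf" where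
  "overlap_law S \<beta> w =
     map_pmf (\<lambda>(\<pi>, \<pi>'). card (\<pi> \<inter> \<pi>')) (pair_pmf (gibbs S \<beta> w) (gibbs S \<beta> w))"


section \<open>Weak convergence in probability of random laws\<close>

text \<open>Measurability is part of the definition because \<^const>\<open>measure\<close> is 0 on non-measurable sets.\<close>

definition converges_in_prob ::
  "(nat \<Rightarrow> 'w measure) \<Rightarrow> (nat \<Rightarrow> 'w \<Rightarrow> real) \<Rightarrow> real \<Rightarrow> bool" where
  "converges_in_prob M X a \<longleftrightarrow>
     (\<forall>\<^sub>F n in sequentially. X n \<in> borel_measurable (M n)) \<and>
     (\<forall>\<epsilon>>0. (\<lambda>n. measure (M n) {x \<in> space (M n). \<bar>X n x - a\<bar> > \<epsilon>}) \<longlonglongrightarrow> 0)"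

text \<open>
  Finite intersections of the sets of laws \<open>r\<close> with \<open>\<bar>\<integral>f dr - \<integral>f dq\<bar> < \<epsilon>\<close>, for \<open>f\<close> bounded and
  continuous, form a neighbourhood base of \<open>q\<close> in the weak topology. Hence the following says
  that the probability that \<open>Q n\<close> lies in any given weak neighbourhood of \<open>q\<close> tends to 1.
\<close>

definition weak_conv_in_prob ::
  "(nat \<Rightarrow> 'w measure) \<Rightarrow> (nat \<Rightarrow> 'w \<Rightarrow> 'a::topological_space pmf) \<Rightarrow> 'a pmf \<Rightarrow> bool" where
  "weak_conv_in_prob M Q q \<longleftrightarrow>
     (\<forall>f :: 'a \<Rightarrow> real. continuous_on UNIV f \<and> bounded (range f) \<longrightarrow>
        converges_in_prob M (\<lambda>n x. measure_pmf.expectation (Q n x) f)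
          (measure_pmf.expectation q f))"

end

theory Submission
  imports Defs
begin

text \<open>
  Normalise the weights to \<open>X e = boltzmann \<beta> (\<omega> e) / L\<close> with mean 1 and second moment \<open>s\<close>. The
  normalised partition function \<open>N\<close> (the average over \<open>\<pi> \<in> S\<close> of \<open>\<Prod>e\<in>\<pi>. X e\<close>) does not
  concentrate, so it is compared in mean square with the one of independent edge percolation of
  density \<open>p\<close>, which is the explicit product \<open>N' = (\<Prod>e. 1 - p + p * X e)\<close>. The bilinear forms
  \<open>\<Sum>\<pi>,\<pi>'. u ^ card (\<pi> \<inter> \<pi>')\<close> for two uniform, two percolation, and one uniform and one percolation
  sample all tend to \<open>exp (2 * \<gamma> * (u - 1))\<close>; this is where the assumptions on matchings enter.
  Taking \<open>u = 3 * s\<close> controls \<open>\<Sum>\<Gamma>. 2 ^ card \<Gamma> * (N \<Gamma> - N' \<Gamma>)\<^sup>2\<close>, where \<open>N \<Gamma>\<close> and \<open>N' \<Gamma>\<close>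
  are the contributions of the \<open>\<pi>\<close> containing \<open>\<Gamma>\<close>. A bounded function of the overlap has Newton
  coefficients at most \<open>2 ^ k\<close> times its bound, so its unnormalised Gibbs expectation can be replaced
  by the percolation one. There it equals \<open>N'\<^sup>2\<close> times the expectation under a sum of independent
  trials with success probabilities \<open>(p * X e / (1 - p + p * X e))\<^sup>2\<close>, which is almost Poisson by Le Cam's
  inequality and the law of large numbers. Finally \<open>1 / N'\<close> has bounded mean, so dividing is harmless.
\<close>

section \<open>Newton series and sums over subsets\<close>

text \<open>\<open>newton f k\<close> is the \<open>k\<close>-th forward difference of
  \<open>f\<close> at 0, that is, the coefficient of \<open>j choose k\<close> in the Newton series
  of \<open>f j\<close>.\<close>

primrec newton :: "(nat \<Rightarrow> real) \<Rightarrow> nat \<Rightarrow> real" where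
  "newton f 0 = f 0"
| "newton f (Suc k) = newton (\<lambda>j. f (Suc j) - f j) k"

lemma newton_diff: "newton (\<lambda>j. f j - g j) k = newton f k - newton g k"
proof (induction k arbitrary: f g)
  case (Suc k)
  have "newton (\<lambda>j. f j - g j) (Suc k) = newton (\<lambda>j. (f (Suc j) - f j) - (g (Suc j) - g j)) k"
    by (simp add: algebra_simps)
  then show ?case by (simp only: Suc newton.simps)
qed simp

lemma newton_cmult: "newton (\<lambda>j. c * f j) k = c * newton f k"
proof (induction k arbitrary: f)
  case (Suc k)
  have "newton (\<lambda>j. c * f j) (Suc k) = newton (\<lambda>j. c * (f (Suc j) - f j)) k"
    by (simp add: algebra_simps)
  then show ?case by (simp only: Suc newton.simps)
qed simp

lemma newton_power: "newton (\<lambda>j. u ^ j) k = (u - 1) ^ k"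
proof (induction k)
  case (Suc k)
  have "newton (\<lambda>j. u ^ j) (Suc k) = newton (\<lambda>j. (u - 1) * u ^ j) k"
    by (simp add: algebra_simps)
  then show ?case by (simp only: newton_cmult Suc power_Suc)
qed simp

text \<open>Each differencing at most doubles the supremum. This is the origin of the weights
  \<open>2 ^ card \<Gamma>\<close> below.\<close>

lemma abs_newton_le:
  assumes "\<And>j. \<bar>f j\<bar> \<le> B"
  shows "\<bar>newton f k\<bar> \<le> 2 ^ k * B"
  using assms
proof (induction k arbitrary: f B)
  case (Suc k)
  have "\<bar>f (Suc j) - f j\<bar> \<le> 2 * B" for j
    using Suc.prems[of "Suc j"] Suc.prems[of j] by linarith
  from Suc.IH[of "\<lambda>j. f (Suc j) - f j", OF this] show ?case by (simp add: mult_ac)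
qed simp

lemma sum_Pow_insert:
  fixes g :: "'e set \<Rightarrow> real"
  assumes "finite A" "a \<notin> A"
  shows "(\<Sum>\<Gamma>\<in>Pow (insert a A). g \<Gamma>) = (\<Sum>\<Gamma>\<in>Pow A. g \<Gamma>) + (\<Sum>\<Gamma>\<in>Pow A. g (insert a \<Gamma>))"
proof -
  have "(\<Sum>\<Gamma>\<in>Pow (insert a A). g \<Gamma>) = (\<Sum>\<Gamma>\<in>Pow A. g \<Gamma>) + (\<Sum>\<Gamma>\<in>insert a ` Pow A. g \<Gamma>)"
    unfolding Pow_insert by (rule sum.union_disjoint) (use assms in auto)
  also have "(\<Sum>\<Gamma>\<in>insert a ` Pow A. g \<Gamma>) = (\<Sum>\<Gamma>\<in>Pow A. g (insert a \<Gamma>))"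
    by (subst sum.reindex) (use assms in \<open>auto intro!: inj_onI simp: o_def\<close>)
  finally show ?thesis .
qed

text \<open>If the \<open>y e\<close> are success probabilities of independent trials, these sums
  are expectations of \<open>f\<close> at the number of successes, and the identity conditions on
  trial \<open>a\<close>: a success shifts \<open>f\<close> by one. Algebraically it holds for all
  real \<open>y\<close>.\<close>

lemma sum_newton_prod_insert:
  fixes y :: "'e \<Rightarrow> real"
  assumes "finite A" "a \<notin> A"
  shows "(\<Sum>\<Gamma>\<in>Pow (insert a A). newton f (card \<Gamma>) * prod y \<Gamma>) =
    (1 - y a) * (\<Sum>\<Gamma>\<in>Pow A. newton f (card \<Gamma>) * prod y \<Gamma>) +
    y a * (\<Sum>\<Gamma>\<in>Pow A. newton (\<lambda>j. f (Suc j)) (card \<Gamma>) * prod y \<Gamma>)"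
proof -
  have "(\<Sum>\<Gamma>\<in>Pow A. newton f (card (insert a \<Gamma>)) * prod y (insert a \<Gamma>)) =
    (\<Sum>\<Gamma>\<in>Pow A. y a * (newton (\<lambda>j. f (Suc j)) (card \<Gamma>) * prod y \<Gamma>
        - newton f (card \<Gamma>) * prod y \<Gamma>))"
  proof (rule sum.cong)
    fix \<Gamma> assume "\<Gamma> \<in> Pow A"
    then have "finite \<Gamma>" "a \<notin> \<Gamma>" using assms finite_subset by auto
    then show "newton f (card (insert a \<Gamma>)) * prod y (insert a \<Gamma>) =
      y a * (newton (\<lambda>j. f (Suc j)) (card \<Gamma>) * prod y \<Gamma> - newton f (card \<Gamma>) * prod y \<Gamma>)"
      by (simp add: newton_diff algebra_simps)
  qed simp
  then show ?thesis
    by (simp add: sum_Pow_insert[OF assms] sum_distrib_left[symmetric] sum_subtractf algebra_simps)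
qed

text \<open>Newton's forward formula, with the binomial coefficient \<open>card A choose k\<close>
  replaced by a sum over the \<open>k\<close>-element subsets.\<close>

lemma sum_newton_card:
  assumes "finite A"
  shows "(\<Sum>\<Gamma>\<in>Pow A. newton f (card \<Gamma>)) = f (card A)"
  using assms
proof (induction A arbitrary: f)
  case (insert a A)
  then show ?case
    using sum_newton_prod_insert[of A a f "\<lambda>_. 1"] by simp
qed simp

section \<open>Overlap forms and their diagonalisation\<close>

definition above :: "'e set \<Rightarrow> ('e set \<Rightarrow> real) \<Rightarrow> ('e \<Rightarrow> real) \<Rightarrow> 'e set \<Rightarrow> real" where
  "above E a x \<Gamma> = (\<Sum>\<pi>\<in>Pow E. of_bool (\<Gamma> \<subseteq> \<pi>) * (a \<pi> * prod x \<pi>))"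

definition overlap_form :: "'e set \<Rightarrow> ('e set \<Rightarrow> real) \<Rightarrow> ('e \<Rightarrow> real) \<Rightarrow> (nat \<Rightarrow> real) \<Rightarrow> real" where
  "overlap_form E a x f =
    (\<Sum>\<pi>\<in>Pow E. \<Sum>\<pi>'\<in>Pow E. f (card (\<pi> \<inter> \<pi>')) * ((a \<pi> * prod x \<pi>) * (a \<pi>' * prod x \<pi>')))"

text \<open>Newton's formula writes \<open>f (card (\<pi> \<inter> \<pi>'))\<close> as a sum over
  \<Gamma> contained in both sets. For fixed \<Gamma> this condition splits into one on each sample,
  so the double sum becomes a square: the form is diagonal in the coordinates
  \<open>above\<close>.\<close>

lemma overlap_form_eq:
  assumes "finite E"
  shows "overlap_form E a x f = (\<Sum>\<Gamma>\<in>Pow E. newton f (card \<Gamma>) * (above E a x \<Gamma>)\<^sup>2)"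
proof -
  have f: "f (card (\<pi> \<inter> \<pi>')) =
      (\<Sum>\<Gamma>\<in>Pow E. newton f (card \<Gamma>) * of_bool (\<Gamma> \<subseteq> \<pi>) * of_bool (\<Gamma> \<subseteq> \<pi>'))"
    if "\<pi> \<in> Pow E" for \<pi> \<pi>'
  proof -
    have "f (card (\<pi> \<inter> \<pi>')) = (\<Sum>\<Gamma>\<in>Pow (\<pi> \<inter> \<pi>'). newton f (card \<Gamma>))"
      using assms that finite_subset by (subst sum_newton_card) auto
    also have "\<dots> = (\<Sum>\<Gamma>\<in>Pow E. newton f (card \<Gamma>) * of_bool (\<Gamma> \<subseteq> \<pi>) * of_bool (\<Gamma> \<subseteq> \<pi>'))"
      using assms that by (intro sum.mono_neutral_cong_left) auto
    finally show ?thesis .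
  qed
  have "overlap_form E a x f = (\<Sum>\<pi>\<in>Pow E. \<Sum>\<pi>'\<in>Pow E. \<Sum>\<Gamma>\<in>Pow E.
      newton f (card \<Gamma>) * ((of_bool (\<Gamma> \<subseteq> \<pi>) * (a \<pi> * prod x \<pi>)) * (of_bool (\<Gamma> \<subseteq> \<pi>') * (a \<pi>' * prod x \<pi>'))))"
    unfolding overlap_form_def
    by (intro sum.cong refl) (simp add: f sum_distrib_right sum_distrib_left mult_ac)
  also have "\<dots> = (\<Sum>\<pi>\<in>Pow E. \<Sum>\<Gamma>\<in>Pow E. \<Sum>\<pi>'\<in>Pow E. 
      newton f (card \<Gamma>) * ((of_bool (\<Gamma> \<subseteq> \<pi>) * (a \<pi> * prod x \<pi>)) * (of_bool (\<Gamma> \<subseteq> \<pi>') * (a \<pi>' * prod x \<pi>'))))"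
    by (intro sum.cong refl sum.swap)
  also have "\<dots> = (\<Sum>\<Gamma>\<in>Pow E. \<Sum>\<pi>\<in>Pow E. \<Sum>\<pi>'\<in>Pow E. 
      newton f (card \<Gamma>) * ((of_bool (\<Gamma> \<subseteq> \<pi>) * (a \<pi> * prod x \<pi>)) * (of_bool (\<Gamma> \<subseteq> \<pi>') * (a \<pi>' * prod x \<pi>'))))"
    by (rule sum.swap)
  also have "\<dots> = (\<Sum>\<Gamma>\<in>Pow E. newton f (card \<Gamma>) * (above E a x \<Gamma>)\<^sup>2)"
    unfolding above_def power2_eq_square sum_product
    by (simp only: sum_distrib_left)
  finally show ?thesis .
qed

lemma overlap_form_1:
  assumes "finite E"
  shows "overlap_form E a x (\<lambda>_. 1) = (above E a x {})\<^sup>2"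
  unfolding overlap_form_def above_def by (simp add: power2_eq_square sum_product)


section \<open>The Poisson law\<close>

text \<open>The expectation of \<open>f\<close> under the Poisson law of rate \<open>a\<close>, as a
  power series that makes sense for every real \<open>a\<close>. Hence it can be differentiated in
  the rate, also at 0.\<close>

definition poisson_mean :: "(nat \<Rightarrow> real) \<Rightarrow> real \<Rightarrow> real" where
  "poisson_mean f a = exp (- a) * (\<Sum>k. f k / fact k * a ^ k)"

lemma summable_poisson_mean:
  fixes f :: "nat \<Rightarrow> real"
  assumes "\<And>j. \<bar>f j\<bar> \<le> B"
  shows "summable (\<lambda>k. f k / fact k * a ^ k)" "summable (\<lambda>k. \<bar>f k / fact k * a ^ k\<bar>)"
proof -
  have s: "summable (\<lambda>k. B * (\<bar>a\<bar> ^ k / fact k))"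
    using summable_exp[of "\<bar>a\<bar>"] by (intro summable_mult) (simp add: field_simps)
  have "norm \<bar>f k / fact k * a ^ k\<bar> \<le> B * (\<bar>a\<bar> ^ k / fact k)" for k
    using mult_right_mono[OF assms[of k], of "\<bar>a\<bar> ^ k / fact k"]
    by (simp add: abs_mult power_abs)
  then show "summable (\<lambda>k. \<bar>f k / fact k * a ^ k\<bar>)"
    by (intro summable_comparison_test'[OF s]) auto
  then show "summable (\<lambda>k. f k / fact k * a ^ k)"
    by (rule summable_rabs_cancel)
qed

lemma expectation_poisson_pmf:
  assumes "\<And>j. \<bar>f j\<bar> \<le> B" "l > 0"
  shows "measure_pmf.expectation (poisson_pmf l) f = poisson_mean f l"
proof -
  let ?g = "\<lambda>k. exp (- l) * (f k / fact k * l ^ k)"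
  have "measure_pmf.expectation (poisson_pmf l) f
      = (\<integral>k. pmf (poisson_pmf l) k *\<^sub>R f k \<partial>count_space UNIV)"
    unfolding measure_pmf_eq_density by (subst integral_density) auto
  also have "\<dots> = (\<integral>k. ?g k \<partial>count_space UNIV)"
    using assms(2) by (simp add: mult_ac)
  also have "\<dots> = suminf ?g"
  proof -
    have "summable (\<lambda>k. exp (- l) * \<bar>f k / fact k * l ^ k\<bar>)"
      by (intro summable_mult summable_poisson_mean(2)[OF assms(1)])
    moreover have "norm (?g k) = exp (- l) * \<bar>f k / fact k * l ^ k\<bar>" for k
      by (simp add: abs_mult)
    ultimately have "integrable (count_space UNIV) ?g"
      by (simp add: integrable_count_space_nat_iff del: real_norm_def)
    then show ?thesis by (rule sums_unique[OF sums_integral_count_space_nat])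
  qed
  also have "\<dots> = poisson_mean f l"
    unfolding poisson_mean_def by (rule suminf_mult[OF summable_poisson_mean(1)[OF assms(1)]])
  finally show ?thesis .
qed

lemma abs_poisson_mean_le:
  assumes "\<And>j. \<bar>f j\<bar> \<le> B" "a \<ge> 0"
  shows "\<bar>poisson_mean f a\<bar> \<le> B"
proof -
  have e: "(\<lambda>k. B * (a ^ k / fact k)) sums (B * exp a)"
    using exp_converges[of a] by (intro sums_mult) (simp add: field_simps)
  have "\<bar>\<Sum>k. f k / fact k * a ^ k\<bar> \<le> (\<Sum>k. \<bar>f k / fact k * a ^ k\<bar>)"
    by (rule summable_rabs[OF summable_poisson_mean(2)[OF assms(1)]])
  also have "\<dots> \<le> (\<Sum>k. B * (a ^ k / fact k))"
  proof (intro suminf_le summable_poisson_mean(2)[OF assms(1)] sums_summable[OF e])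
    fix k show "\<bar>f k / fact k * a ^ k\<bar> \<le> B * (a ^ k / fact k)"
      using mult_right_mono[OF assms(1)[of k], of "\<bar>a\<bar> ^ k / fact k"] assms(2)
      by (simp add: abs_mult power_abs)
  qed
  also have "\<dots> = B * exp a" by (rule sums_unique[OF e, symmetric])
  finally have "exp (- a) * \<bar>\<Sum>k. f k / fact k * a ^ k\<bar> \<le> exp (- a) * (B * exp a)"
    by (intro mult_left_mono) auto
  moreover have "exp (- a) * (B * exp a) = B" by (simp add: exp_minus field_simps)
  ultimately show ?thesis by (simp add: poisson_mean_def abs_mult)
qed

lemma poisson_mean_diff:
  assumes "\<And>j. \<bar>f j\<bar> \<le> B" "\<And>j. \<bar>g j\<bar> \<le> C"
  shows "poisson_mean (\<lambda>j. f j - g j) a = poisson_mean f a - poisson_mean g a"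
  unfolding poisson_mean_def
  by (subst right_diff_distrib[symmetric],
      subst suminf_diff[OF summable_poisson_mean(1)[OF assms(1)] summable_poisson_mean(1)[OF assms(2)]])
     (simp add: algebra_simps diff_divide_distrib)

text \<open>Differentiating the series termwise shifts \<open>f\<close> by one, and differentiating
  \<open>exp (- a)\<close> subtracts the original mean. So the derivative in the rate is the mean of
  the forward difference.\<close>

lemma poisson_mean_deriv:
  assumes f: "\<And>j. \<bar>f j\<bar> \<le> B"
  shows "(poisson_mean f has_real_derivative poisson_mean (\<lambda>j. f (Suc j) - f j) a) (at a)"
proof -
  let ?c = "\<lambda>k. f k / fact k"
  have d: "diffs ?c = (\<lambda>k. f (Suc k) / fact k)"
    by (auto simp: diffs_def fun_eq_iff simp del: of_nat_Suc)
  have "((\<lambda>x. \<Sum>k. ?c k * x ^ k) has_real_derivative (\<Sum>k. f (Suc k) / fact k * a ^ k)) (at a)"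
    using termdiffs_strong_converges_everywhere[of ?c a, OF summable_poisson_mean(1)[of f B, OF f]]
    unfolding d .
  then have "(poisson_mean f has_real_derivative
     (exp (- a) * (\<Sum>k. f (Suc k) / fact k * a ^ k) + - exp (- a) * (\<Sum>k. ?c k * a ^ k))) (at a)"
    unfolding poisson_mean_def[abs_def]
    by (auto intro!: derivative_eq_intros)
  then show ?thesis
    using poisson_mean_diff[of "\<lambda>j. f (Suc j)" B f B a] f by (simp add: poisson_mean_def)
qed

lemma poisson_mean_lipschitz:
  assumes f: "\<And>j. \<bar>f j\<bar> \<le> B" and "a \<ge> 0" "b \<ge> 0"
  shows "\<bar>poisson_mean f a - poisson_mean f b\<bar> \<le> 2 * B * \<bar>a - b\<bar>"
proof -
  have "\<bar>f (Suc j) - f j\<bar> \<le> 2 * B" for j using f[of j] f[of "Suc j"] by linarith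
  then have "norm (poisson_mean (\<lambda>j. f (Suc j) - f j) x) \<le> 2 * B" if "x \<in> {0..}" for x
    using that abs_poisson_mean_le by simp
  then have "norm (poisson_mean f a - poisson_mean f b) \<le> 2 * B * norm (a - b)"
    using assms(2,3) poisson_mean_deriv[of f B, OF f]
    by (intro field_differentiable_bound[where S = "{0..}" and f' = "poisson_mean (\<lambda>j. f (Suc j) - f j)"])
       (auto intro: has_field_derivative_at_within)
  then show ?thesis by simp
qed

text \<open>Adding one trial of success probability \<open>y\<close> agrees to first order with
  raising the rate by \<open>y\<close>. The Taylor remainder contains half of a mean of second
  differences, which are at most \<open>4 * B\<close>; hence the constant
  \<open>2 * B\<close>.\<close>

lemma poisson_mean_step:
  assumes f: "\<And>j. \<bar>f j\<bar> \<le> B" and "a \<ge> 0" "y \<ge> 0"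
  shows "\<bar>(1 - y) * poisson_mean f a + y * poisson_mean (\<lambda>j. f (Suc j)) a - poisson_mean f (a + y)\<bar>
    \<le> 2 * B * y\<^sup>2"
proof (cases "y = 0")
  case False
  let ?g = "\<lambda>j. f (Suc j) - f j" and ?h = "\<lambda>j. (f (Suc (Suc j)) - f (Suc j)) - (f (Suc j) - f j)"
  have g: "\<bar>?g j\<bar> \<le> 2 * B" for j using f[of j] f[of "Suc j"] by linarith
  have h: "\<bar>?h j\<bar> \<le> 4 * B" for j using g[of j] g[of "Suc j"] by linarith
  \<comment> \<open>The nested conditional lists the derivatives of order 0, 1 and 2. Taylor's
    theorem needs a proper interval, which is why \<open>y = 0\<close> is treated apart.\<close>
  have "\<exists>t. a < t \<and> t < a + y \<and> poisson_mean f (a + y) =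
     (\<Sum>m<2. ((\<lambda>m::nat. if m = 0 then poisson_mean f else if m = 1 then poisson_mean ?g else poisson_mean ?h) m a) / fact m * (a + y - a)^m)
     + ((\<lambda>m::nat. if m = 0 then poisson_mean f else if m = 1 then poisson_mean ?g else poisson_mean ?h) 2 t) / fact 2 * (a + y - a)^2"
    using False assms(2,3) poisson_mean_deriv[of f B, OF f] poisson_mean_deriv[of ?g "2 * B", OF g]
    by (intro Taylor_up[where b = "a + y"]) (auto simp: less_2_cases_iff)
  then obtain t where t: "a < t" and
    eq: "poisson_mean f (a + y) = poisson_mean f a + poisson_mean ?g a * y + poisson_mean ?h t / 2 * y\<^sup>2"
    by (auto simp: numeral_2_eq_2)
  have "\<bar>poisson_mean ?h t\<bar> \<le> 4 * B"
    using t assms(2) by (intro abs_poisson_mean_le h) auto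
  then have "\<bar>poisson_mean ?h t\<bar> / 2 * y\<^sup>2 \<le> 2 * B * y\<^sup>2"
    by (intro mult_right_mono) auto
  moreover have g_eq: "poisson_mean (\<lambda>j. f (Suc j)) a = poisson_mean ?g a + poisson_mean f a"
    using poisson_mean_diff[of "\<lambda>j. f (Suc j)" B f B a] f by simp
  have "(1 - y) * poisson_mean f a + y * poisson_mean (\<lambda>j. f (Suc j)) a - poisson_mean f (a + y)
      = - (poisson_mean ?h t / 2 * y\<^sup>2)"
    unfolding eq g_eq by (simp add: algebra_simps)
  ultimately show ?thesis by (simp only: abs_minus_cancel abs_mult) simp
qed simp

text \<open>Le Cam's inequality: the sum over \<open>\<Gamma>\<close> is the expectation of \<open>f\<close> at the number of successes of
  independent trials with success probabilities \<open>y e\<close>.\<close>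

lemma le_cam:
  fixes y :: "'e \<Rightarrow> real"
  assumes "finite F" "\<And>e. e \<in> F \<Longrightarrow> 0 \<le> y e \<and> y e \<le> 1" "\<And>j. \<bar>f j\<bar> \<le> B"
  shows "\<bar>(\<Sum>\<Gamma>\<in>Pow F. newton f (card \<Gamma>) * prod y \<Gamma>) - poisson_mean f (sum y F)\<bar>
    \<le> 2 * B * (\<Sum>e\<in>F. (y e)\<^sup>2)"
  using assms
proof (induction F arbitrary: f)
  case empty
  have "(\<Sum>k. f k / fact k * 0 ^ k) = f 0"
    using powser_zero[of "\<lambda>k. f k / fact k"] by simp
  then show ?case by (simp add: poisson_mean_def)
next
  case (insert e F)
  let ?h = "\<lambda>f. \<Sum>\<Gamma>\<in>Pow F. newton f (card \<Gamma>) * prod y \<Gamma>"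
  let ?f' = "\<lambda>j. f (Suc j)" and ?a = "sum y F" and ?r = "2 * B * (\<Sum>e\<in>F. (y e)\<^sup>2)"
  have y: "0 \<le> y e" "y e \<le> 1" using insert.prems by auto
  have a: "?a \<ge> 0" using insert.prems by (intro sum_nonneg) auto
  have 1: "\<bar>?h f - poisson_mean f ?a\<bar> \<le> ?r" using insert.prems by (intro insert.IH) auto
  have 2: "\<bar>?h ?f' - poisson_mean ?f' ?a\<bar> \<le> ?r" using insert.prems by (intro insert.IH) auto
  have 3: "\<bar>(1 - y e) * poisson_mean f ?a + y e * poisson_mean ?f' ?a - poisson_mean f (?a + y e)\<bar>
      \<le> 2 * B * (y e)\<^sup>2"
    by (rule poisson_mean_step[OF insert.prems(2) a y(1)])
  have "\<bar>(1 - y e) * (?h f - poisson_mean f ?a)\<bar> \<le> (1 - y e) * ?r"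
    using 1 y by (auto simp: abs_mult intro!: mult_left_mono)
  moreover have "\<bar>y e * (?h ?f' - poisson_mean ?f' ?a)\<bar> \<le> y e * ?r"
    using 2 y by (auto simp: abs_mult intro!: mult_left_mono)
  \<comment> \<open>The errors of the two branches are averaged with weights \<open>1 - y e\<close>
    and \<open>y e\<close>, so the accumulated error \<open>?r\<close> is carried over without
    growth.\<close>
  ultimately have "\<bar>(1 - y e) * (?h f - poisson_mean f ?a) + y e * (?h ?f' - poisson_mean ?f' ?a)\<bar> \<le> ?r"
    by (simp add: algebra_simps)
  with 3 have "\<bar>(1 - y e) * ?h f + y e * ?h ?f' - poisson_mean f (?a + y e)\<bar> \<le> ?r + 2 * B * (y e)\<^sup>2"
    by (simp add: algebra_simps)
  then show ?case
    unfolding sum_newton_prod_insert[OF insert.hyps]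
    using insert.hyps by (simp add: algebra_simps)
qed

section \<open>Uniform and independent sampling of edges\<close>

definition percolation :: "'e set \<Rightarrow> real \<Rightarrow> 'e set \<Rightarrow> real" where
  "percolation E p \<pi> = p ^ card \<pi> * (1 - p) ^ card (E - \<pi>)"

definition uniform :: "'e set set \<Rightarrow> 'e set \<Rightarrow> real" where
  "uniform S \<pi> = of_bool (\<pi> \<in> S) / real (card S)"

definition overlap_pairing :: "'e set \<Rightarrow> ('e set \<Rightarrow> real) \<Rightarrow> ('e set \<Rightarrow> real) \<Rightarrow> real \<Rightarrow> real" where
  "overlap_pairing E a b u = (\<Sum>\<pi>\<in>Pow E. \<Sum>\<pi>'\<in>Pow E. u ^ card (\<pi> \<inter> \<pi>') * (a \<pi> * b \<pi>'))"

lemma overlap_form_unit_weights: "overlap_form E a (\<lambda>_. 1) (\<lambda>k. u ^ k) = overlap_pairing E a a u"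
  by (simp add: overlap_form_def overlap_pairing_def)

lemma overlap_pairing_sym: "overlap_pairing E a b u = overlap_pairing E b a u"
  unfolding overlap_pairing_def by (subst sum.swap) (simp add: Int_commute mult.commute)

lemma overlap_pairing_diff:
  "overlap_pairing E (\<lambda>\<pi>. a \<pi> - b \<pi>) (\<lambda>\<pi>. a \<pi> - b \<pi>) u =
    overlap_pairing E a a u - 2 * overlap_pairing E a b u + overlap_pairing E b b u"
proof -
  have "overlap_pairing E (\<lambda>\<pi>. a \<pi> - b \<pi>) (\<lambda>\<pi>. a \<pi> - b \<pi>) u =
    overlap_pairing E a a u - overlap_pairing E a b u - overlap_pairing E b a u + overlap_pairing E b b u"
    unfolding overlap_pairing_def by (simp add: algebra_simps sum.distrib sum_subtractf)
  then show ?thesis by (simp add: overlap_pairing_sym[of E b a])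
qed

text \<open>Percolation and the weights both factorise over edges, so the sum over \<pi> is an
  expanded product. The requirement that \<pi> contains \<Gamma> is encoded by giving absence of an
  edge of \<Gamma> the weight 0.\<close>

lemma above_percolation:
  assumes "finite E" "\<Gamma> \<subseteq> E"
  shows "above E (percolation E p) x \<Gamma> = (\<Prod>e\<in>\<Gamma>. p * x e) * (\<Prod>e\<in>E - \<Gamma>. 1 - p + p * x e)"
proof -
  let ?f = "\<lambda>e. p * x e" and ?g = "\<lambda>e. if e \<in> \<Gamma> then 0 else 1 - p"
  have "above E (percolation E p) x \<Gamma> = (\<Sum>\<pi>\<in>Pow E. prod ?f \<pi> * prod ?g (E - \<pi>))"
    unfolding above_def
  proof (rule sum.cong)
    fix \<pi> assume \<pi>: "\<pi> \<in> Pow E"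
    have "prod ?g (E - \<pi>) = of_bool (\<Gamma> \<subseteq> \<pi>) * (1 - p) ^ card (E - \<pi>)"
    proof (cases "\<Gamma> \<subseteq> \<pi>")
      case True
      then have "prod ?g (E - \<pi>) = (\<Prod>e\<in>E - \<pi>. 1 - p)" by (intro prod.cong) auto
      then show ?thesis using True by simp
    next
      case False
      then have "\<exists>e\<in>E - \<pi>. ?g e = 0" using assms(2) by auto
      then show ?thesis using False assms(1) by (simp add: prod_zero)
    qed
    then show "of_bool (\<Gamma> \<subseteq> \<pi>) * (percolation E p \<pi> * prod x \<pi>) = prod ?f \<pi> * prod ?g (E - \<pi>)"
      by (simp add: percolation_def prod.distrib)
  qed simp
  also have "\<dots> = (\<Prod>e\<in>E. ?f e + ?g e)"
    by (rule prod_add[OF assms(1), symmetric])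
  also have "\<dots> = (\<Prod>e\<in>E - \<Gamma>. ?f e + ?g e) * (\<Prod>e\<in>\<Gamma>. ?f e + ?g e)"
    by (rule prod.subset_diff[OF assms(2,1)])
  also have "(\<Prod>e\<in>E - \<Gamma>. ?f e + ?g e) = (\<Prod>e\<in>E - \<Gamma>. 1 - p + p * x e)"
    by (intro prod.cong) auto
  also have "(\<Prod>e\<in>\<Gamma>. ?f e + ?g e) = (\<Prod>e\<in>\<Gamma>. p * x e)"
    by (intro prod.cong) auto
  finally show ?thesis by (simp add: mult.commute)
qed

text \<open>The power of \<open>u\<close> is the product over \<pi>' of edge weights equal to
  \<open>u\<close> on \<pi> and 1 elsewhere, so the sum is an instance of \<open>above\<close> at
  the empty set.\<close>

lemma sum_percolation_power:
  assumes "finite E" "\<pi> \<subseteq> E"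
  shows "(\<Sum>\<pi>'\<in>Pow E. u ^ card (\<pi> \<inter> \<pi>') * percolation E p \<pi>') = (1 + p * (u - 1)) ^ card \<pi>"
proof -
  let ?x = "\<lambda>e. if e \<in> \<pi> then u else 1"
  have x: "prod ?x \<pi>' = u ^ card (\<pi> \<inter> \<pi>')" if "\<pi>' \<subseteq> E" for \<pi>'
  proof -
    have "finite \<pi>'" using that assms(1) finite_subset by blast
    then have "prod ?x \<pi>' = (\<Prod>e\<in>\<pi>' \<inter> \<pi>. u)" by (simp add: prod.If_cases)
    then show ?thesis by (simp add: Int_commute)
  qed
  have "(\<Sum>\<pi>'\<in>Pow E. u ^ card (\<pi> \<inter> \<pi>') * percolation E p \<pi>') = above E (percolation E p) ?x {}"
    unfolding above_def using x by (intro sum.cong) auto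
  also have "\<dots> = (\<Prod>e\<in>E. if e \<in> \<pi> then 1 + p * (u - 1) else 1)"
    unfolding above_percolation[OF assms(1) empty_subsetI] by (auto intro!: prod.cong simp: algebra_simps)
  also have "\<dots> = (1 + p * (u - 1)) ^ card \<pi>"
    using assms by (simp add: prod.If_cases Int_absorb1)
  finally show ?thesis .
qed

lemma overlap_pairing_percolation:
  assumes "finite E"
  shows "overlap_pairing E (percolation E p) (percolation E p) u = (1 + p\<^sup>2 * (u - 1)) ^ card E"
proof -
  have "overlap_pairing E (percolation E p) (percolation E p) u =
    (\<Sum>\<pi>\<in>Pow E. percolation E p \<pi> * (\<Sum>\<pi>'\<in>Pow E. u ^ card (\<pi> \<inter> \<pi>') * percolation E p \<pi>'))"
    unfolding overlap_pairing_def by (simp add: sum_distrib_left mult_ac)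
  \<comment> \<open>Writing \<open>card \<pi>\<close> as \<open>card (E \<inter> \<pi>)\<close> lets
    the same lemma apply again, now with the fixed set \<open>E\<close> and base
    \<open>1 + p * (u - 1)\<close>.\<close>
  also have "\<dots> = (\<Sum>\<pi>\<in>Pow E. (1 + p * (u - 1)) ^ card (E \<inter> \<pi>) * percolation E p \<pi>)"
    using assms by (intro sum.cong) (auto simp: sum_percolation_power Int_absorb1)
  also have "\<dots> = (1 + p * ((1 + p * (u - 1)) - 1)) ^ card E"
    by (rule sum_percolation_power[OF assms order_refl])
  finally show ?thesis by (simp add: power2_eq_square mult.assoc)
qed

lemma sum_uniform:
  assumes "finite E" "S \<subseteq> Pow E"
  shows "(\<Sum>\<pi>\<in>Pow E. uniform S \<pi> * g \<pi>) = (\<Sum>\<pi>\<in>S. g \<pi>) / real (card S)"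
proof -
  have "(\<Sum>\<pi>\<in>Pow E. uniform S \<pi> * g \<pi>) = (\<Sum>\<pi>\<in>S. g \<pi> / real (card S))"
    using assms by (intro sum.mono_neutral_cong_right) (auto simp: uniform_def)
  then show ?thesis by (simp add: sum_divide_distrib)
qed

text \<open>Averaging over the percolation sample first leaves a function of the number of edges of
  the other one, which is constant on \<open>S\<close>. So the mixed pairing is exact.\<close>

lemma overlap_pairing_uniform_percolation:
  assumes "finite E" "S \<subseteq> Pow E" "S \<noteq> {}" "\<And>\<pi>. \<pi> \<in> S \<Longrightarrow> card \<pi> = m"
  shows "overlap_pairing E (uniform S) (percolation E p) u = (1 + p * (u - 1)) ^ m"
proof -
  have S: "finite S" using assms(1,2) finite_subset by blast
  have "overlap_pairing E (uniform S) (percolation E p) u =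
    (\<Sum>\<pi>\<in>Pow E. uniform S \<pi> * (\<Sum>\<pi>'\<in>Pow E. u ^ card (\<pi> \<inter> \<pi>') * percolation E p \<pi>'))"
    unfolding overlap_pairing_def by (simp add: sum_distrib_left mult_ac)
  also have "\<dots> = (\<Sum>\<pi>\<in>S. (1 + p * (u - 1)) ^ card \<pi>) / real (card S)"
    unfolding sum_uniform[OF assms(1,2)]
    by (intro arg_cong2[of _ _ _ _ "(/)"] sum.cong refl sum_percolation_power) (use assms(1,2) in auto)
  also have "\<dots> = (\<Sum>\<pi>\<in>S. (1 + p * (u - 1)) ^ m) / real (card S)"
    using assms(4) by simp
  also have "\<dots> = (1 + p * (u - 1)) ^ m"
    using S assms(3) by simp
  finally show ?thesis .
qed

lemma above_uniform:
  assumes "finite E" "S \<subseteq> Pow E" "S \<noteq> {}"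
  shows "above E (uniform S) (\<lambda>_. 1) \<Gamma> = prob_contains S \<Gamma>"
proof -
  have S: "finite S" using assms(1,2) finite_subset by blast
  have "above E (uniform S) (\<lambda>_. 1) \<Gamma> = (\<Sum>\<pi>\<in>Pow E. uniform S \<pi> * of_bool (\<Gamma> \<subseteq> \<pi>))"
    by (simp add: above_def mult.commute)
  also have "\<dots> = real (card (S \<inter> {\<pi>. \<Gamma> \<subseteq> \<pi>})) / real (card S)"
    using S by (simp add: sum_uniform[OF assms(1,2)] of_bool_def sum.If_cases)
  finally show ?thesis using S assms(3) by (simp add: measure_pmf_of_set)
qed

text \<open>This is where the containment probabilities of \<open>S\<close> enter: the coordinates
  \<open>above\<close> are exactly these probabilities when all weights are 1.\<close>

lemma overlap_pairing_uniform:
  assumes "finite E" "S \<subseteq> Pow E" "S \<noteq> {}"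
  shows "overlap_pairing E (uniform S) (uniform S) u = (\<Sum>\<Gamma>\<in>Pow E. (u - 1) ^ card \<Gamma> * (prob_contains S \<Gamma>)\<^sup>2)"
  unfolding overlap_form_unit_weights[symmetric] overlap_form_eq[OF assms(1)]
  by (simp add: newton_power above_uniform[OF assms])

text \<open>Weighting percolation by \<open>x\<close> is again percolation up to the normalising
  product, with edge probabilities \<open>p * x e / (1 - p + p * x e)\<close>. An edge is common to
  two independent samples with the square of this probability, and the normalisation comes out
  squared.\<close>

lemma overlap_form_percolation:
  assumes "finite E" "\<And>e. e \<in> E \<Longrightarrow> 1 - p + p * x e \<noteq> 0"
  shows "overlap_form E (percolation E p) x f = (\<Prod>e\<in>E. 1 - p + p * x e)\<^sup>2 *
    (\<Sum>\<Gamma>\<in>Pow E. newton f (card \<Gamma>) * (\<Prod>e\<in>\<Gamma>. (p * x e / (1 - p + p * x e))\<^sup>2))"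
proof -
  have *: "above E (percolation E p) x \<Gamma> =
      (\<Prod>e\<in>E. 1 - p + p * x e) * (\<Prod>e\<in>\<Gamma>. p * x e / (1 - p + p * x e))" if "\<Gamma> \<in> Pow E" for \<Gamma>
  proof -
    have \<Gamma>: "finite \<Gamma>" "\<Gamma> \<subseteq> E" using that assms(1) finite_subset by auto
    then have "(\<Prod>e\<in>\<Gamma>. 1 - p + p * x e) \<noteq> 0" using assms(2) by auto
    then show ?thesis
      unfolding above_percolation[OF assms(1) \<Gamma>(2)] prod.subset_diff[OF \<Gamma>(2) assms(1), of "\<lambda>e. 1 - p + p * x e"]
      by (simp add: prod_dividef field_simps)
  qed
  show ?thesis
    unfolding overlap_form_eq[OF assms(1)] sum_distrib_left
    by (intro sum.cong refl) (simp add: * power_mult_distrib prod_power_distrib mult_ac)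
qed

section \<open>Comparison of the overlap forms of two edge laws\<close>

definition overlap_defect :: "'e set \<Rightarrow> ('e set \<Rightarrow> real) \<Rightarrow> ('e set \<Rightarrow> real) \<Rightarrow> ('e \<Rightarrow> real) \<Rightarrow> real" where
  "overlap_defect E a b x = (\<Sum>\<Gamma>\<in>Pow E. 2 ^ card \<Gamma> * \<bar>(above E a x \<Gamma>)\<^sup>2 - (above E b x \<Gamma>)\<^sup>2\<bar>)"

text \<open>Because \<open>2 ^ card \<Gamma>\<close> dominates the Newton coefficients up to the
  factor \<open>B\<close>, the single quantity \<open>overlap_defect\<close> controls the comparison
  for every bounded \<open>f\<close>.\<close>

lemma overlap_form_diff_le:
  assumes "finite E" "\<And>j. \<bar>f j\<bar> \<le> B"
  shows "\<bar>overlap_form E a x f - overlap_form E b x f\<bar> \<le> B * overlap_defect E a b x"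
proof -
  have "overlap_form E a x f - overlap_form E b x f =
    (\<Sum>\<Gamma>\<in>Pow E. newton f (card \<Gamma>) * ((above E a x \<Gamma>)\<^sup>2 - (above E b x \<Gamma>)\<^sup>2))"
    unfolding overlap_form_eq[OF assms(1)] by (simp add: algebra_simps sum_subtractf)
  also have "\<bar>\<dots>\<bar> \<le> (\<Sum>\<Gamma>\<in>Pow E. \<bar>newton f (card \<Gamma>) * ((above E a x \<Gamma>)\<^sup>2 - (above E b x \<Gamma>)\<^sup>2)\<bar>)"
    by (rule sum_abs)
  also have "\<dots> \<le> (\<Sum>\<Gamma>\<in>Pow E. (2 ^ card \<Gamma> * B) * \<bar>(above E a x \<Gamma>)\<^sup>2 - (above E b x \<Gamma>)\<^sup>2\<bar>)"
    unfolding abs_mult using assms(2) by (intro sum_mono mult_right_mono abs_newton_le) auto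
  finally show ?thesis by (simp add: overlap_defect_def sum_distrib_left mult_ac)
qed

text \<open>A weighted arithmetic-geometric mean inequality for the product of
  \<open>\<bar>a - b\<bar>\<close> and \<open>\<bar>a + b\<bar>\<close>. Keeping \<open>k\<close>
  free replaces a Cauchy-Schwarz step under sums and expectations.\<close>

lemma abs_diff_squares_le:
  fixes a b k :: real
  assumes "k > 0"
  shows "\<bar>a\<^sup>2 - b\<^sup>2\<bar> \<le> (a - b)\<^sup>2 / (2 * k) + k * (a\<^sup>2 + b\<^sup>2)"
proof -
  let ?s = "\<bar>a - b\<bar>" and ?t = "\<bar>a + b\<bar>"
  have "0 \<le> (?s - k * ?t)\<^sup>2" by simp
  then have "2 * k * (?s * ?t) \<le> ?s\<^sup>2 + k\<^sup>2 * ?t\<^sup>2"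
    by (simp add: power2_diff power_mult_distrib algebra_simps)
  then have "?s * ?t \<le> (?s\<^sup>2 + k\<^sup>2 * ?t\<^sup>2) / (2 * k)"
    using assms by (simp add: field_simps)
  also have "\<dots> = (a - b)\<^sup>2 / (2 * k) + k * ((a + b)\<^sup>2 / 2)"
    using assms by (simp add: field_simps power2_eq_square)
  also have "(a + b)\<^sup>2 / 2 \<le> a\<^sup>2 + b\<^sup>2"
    using sum_squares_bound[of a b] by (simp add: power2_sum)
  finally show ?thesis
    using assms by (simp add: abs_mult[symmetric] power2_eq_square algebra_simps)
qed

text \<open>The base 3 appears because the Newton coefficients of \<open>3 ^ j\<close> are
  \<open>2 ^ k\<close>, which are the weights in the defect.\<close>

lemma overlap_defect_le:
  assumes "finite E" "k > 0"
  shows "overlap_defect E a b x \<le> overlap_form E (\<lambda>\<pi>. a \<pi> - b \<pi>) x (\<lambda>j. 3 ^ j) / (2 * k)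
    + k * (overlap_form E a x (\<lambda>j. 3 ^ j) + overlap_form E b x (\<lambda>j. 3 ^ j))"
proof -
  have d: "above E (\<lambda>\<pi>. a \<pi> - b \<pi>) x \<Gamma> = above E a x \<Gamma> - above E b x \<Gamma>" for \<Gamma>
    unfolding above_def by (simp add: algebra_simps sum_subtractf)
  have "overlap_defect E a b x \<le> (\<Sum>\<Gamma>\<in>Pow E. 2 ^ card \<Gamma> *
     ((above E a x \<Gamma> - above E b x \<Gamma>)\<^sup>2 / (2 * k) + k * ((above E a x \<Gamma>)\<^sup>2 + (above E b x \<Gamma>)\<^sup>2)))"
    unfolding overlap_defect_def
    by (intro sum_mono mult_left_mono abs_diff_squares_le assms(2)) auto
  then show ?thesis
    unfolding overlap_form_eq[OF assms(1)] newton_power d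
    by (simp add: algebra_simps sum.distrib sum_distrib_left sum_divide_distrib)
qed

section \<open>Independent normalised weights\<close>

text \<open>Meant for \<open>v = p * x - p\<close> with \<open>x\<close> random of mean 1: the
  linear term then has mean 0, and only a term of order \<open>p^2\<close> survives.\<close>

lemma inverse_one_plus_le:
  fixes v :: real
  assumes "v \<ge> - 1 / 2"
  shows "1 / (1 + v) \<le> 1 - v + 2 * v\<^sup>2"
proof -
  have "(1 - v + 2 * v\<^sup>2) * (1 + v) = 1 + v\<^sup>2 * (1 + 2 * v)"
    by (simp add: algebra_simps power2_eq_square)
  moreover have "0 \<le> v\<^sup>2 * (1 + 2 * v)" using assms by simp
  ultimately show ?thesis using assms by (simp add: divide_le_eq)
qed

text \<open>The denominator is at least 1/2 and differs from 1 by \<open>p * (x - 1)\<close> only.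
  So the success probability is \<open>p^2 * x^2\<close> up to order \<open>p^3\<close>.\<close>

lemma tilted_square_approx:
  fixes p x :: real
  assumes "0 \<le> p" "p \<le> 1 / 2" "x \<ge> 0"
  shows "\<bar>(p * x / (1 - p + p * x))\<^sup>2 - p\<^sup>2 * x\<^sup>2\<bar> \<le> 6 * p ^ 3 * (2 * x\<^sup>2 + x ^ 4)"
    and "((p * x / (1 - p + p * x))\<^sup>2)\<^sup>2 \<le> 16 * p ^ 4 * x ^ 4"
    and "(p * x / (1 - p + p * x))\<^sup>2 \<le> 1"
proof -
  define d where "d = 1 - p + p * x"
  have px: "0 \<le> p * x" using assms by simp
  have d: "d \<ge> 1 / 2" using assms px unfolding d_def by linarith
  have i: "0 \<le> 1 / d" "1 / d \<le> 2" using d by (auto simp: divide_le_eq)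
  have i2: "0 \<le> (1 / d)\<^sup>2" "(1 / d)\<^sup>2 \<le> 4" using power_mono[OF i(2,1), of 2] by auto
  have "(1 / d)\<^sup>2 - 1 = p * (1 - x) * (1 / d + (1 / d)\<^sup>2)"
  proof -
    have "(1 / d)\<^sup>2 - 1 = (1 - d) * (1 / d + (1 / d)\<^sup>2)"
      using d by (simp add: field_simps power2_eq_square)
    then show ?thesis by (simp add: d_def algebra_simps)
  qed
  then have "\<bar>(1 / d)\<^sup>2 - 1\<bar> = p * \<bar>1 - x\<bar> * (1 / d + (1 / d)\<^sup>2)"
    using assms(1) i i2 by (simp add: abs_mult)
  also have "\<dots> \<le> p * (1 + x) * 6"
    using assms i i2 by (intro mult_mono) auto
  finally have "p\<^sup>2 * x\<^sup>2 * \<bar>(1 / d)\<^sup>2 - 1\<bar> \<le> p\<^sup>2 * x\<^sup>2 * (p * (1 + x) * 6)"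
    by (intro mult_left_mono) auto
  also have "\<dots> = 6 * p ^ 3 * (x\<^sup>2 + x ^ 3)"
    by (simp add: algebra_simps power2_eq_square power3_eq_cube)
  \<comment> \<open>The cubic term is absorbed into even powers, so that second and fourth moments
    suffice afterwards.\<close>
  also have "x\<^sup>2 + x ^ 3 \<le> 2 * x\<^sup>2 + x ^ 4"
  proof -
    have "0 \<le> x\<^sup>2 * ((x - 1)\<^sup>2 + x)" using assms(3) by simp
    also have "\<dots> = (2 * x\<^sup>2 + x ^ 4) - (x\<^sup>2 + x ^ 3)"
      by (simp add: power2_eq_square power3_eq_cube power4_eq_xxxx algebra_simps)
    finally show ?thesis by simp
  qed
  finally have "p\<^sup>2 * x\<^sup>2 * \<bar>(1 / d)\<^sup>2 - 1\<bar> \<le> 6 * p ^ 3 * (2 * x\<^sup>2 + x ^ 4)"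
    using assms(1) by (simp add: mult_left_mono)
  moreover have "(p * x / d)\<^sup>2 - p\<^sup>2 * x\<^sup>2 = p\<^sup>2 * x\<^sup>2 * ((1 / d)\<^sup>2 - 1)"
    by (simp add: power_divide power_mult_distrib algebra_simps)
  ultimately show "\<bar>(p * x / (1 - p + p * x))\<^sup>2 - p\<^sup>2 * x\<^sup>2\<bar> \<le> 6 * p ^ 3 * (2 * x\<^sup>2 + x ^ 4)"
    by (simp add: d_def[symmetric] abs_mult)
  have "((p * x / d)\<^sup>2)\<^sup>2 = p ^ 4 * x ^ 4 * ((1 / d)\<^sup>2)\<^sup>2"
    by (simp add: power_divide power_mult_distrib)
  also have "\<dots> \<le> p ^ 4 * x ^ 4 * 4\<^sup>2"
    using i2 by (intro mult_left_mono power_mono) auto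
  finally show "((p * x / (1 - p + p * x))\<^sup>2)\<^sup>2 \<le> 16 * p ^ 4 * x ^ 4"
    by (simp add: d_def[symmetric])
  have "p * x / d \<le> 1" "0 \<le> p * x / d"
    using d px assms(2) by (auto simp: d_def divide_le_eq)
  then show "(p * x / (1 - p + p * x))\<^sup>2 \<le> 1"
    by (simp add: d_def[symmetric] power_le_one)
qed

text \<open>The setting for one fixed graph, with explicit constants \<open>s\<close> and
  \<open>c\<close>, so that all estimates are uniform in the size of the graph.\<close>

locale iid_factors = prob_space M for M :: "'w measure" +
  fixes E :: "'e set" and X :: "'e \<Rightarrow> 'w \<Rightarrow> real" and s c :: real
  assumes finite_E: "finite E"
    and indep_X: "indep_vars (\<lambda>_. borel) X E"
    and X_nonneg: "\<And>e w. e \<in> E \<Longrightarrow> X e w \<ge> 0"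
    and X_integrable: "\<And>e k. e \<in> E \<Longrightarrow> integrable M (\<lambda>w. X e w ^ k)"
    and X_mean: "\<And>e. e \<in> E \<Longrightarrow> expectation (X e) = 1"
    and X_second: "\<And>e. e \<in> E \<Longrightarrow> expectation (\<lambda>w. (X e w)\<^sup>2) = s"
    and X_fourth: "\<And>e. e \<in> E \<Longrightarrow> expectation (\<lambda>w. X e w ^ 4) \<le> c"
begin

lemma X_measurable [measurable]: "e \<in> E \<Longrightarrow> X e \<in> borel_measurable M"
  using indep_X by (simp add: indep_vars_def)

lemma
  fixes g :: "'e \<Rightarrow> real \<Rightarrow> real"
  assumes "A \<subseteq> E" "\<And>e. e \<in> A \<Longrightarrow> g e \<in> borel_measurable borel"
    "\<And>e. e \<in> A \<Longrightarrow> integrable M (\<lambda>w. g e (X e w))"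
  shows expectation_prod: "expectation (\<lambda>w. \<Prod>e\<in>A. g e (X e w)) = (\<Prod>e\<in>A. expectation (\<lambda>w. g e (X e w)))"
    and integrable_prod: "integrable M (\<lambda>w. \<Prod>e\<in>A. g e (X e w))"
proof -
  have A: "finite A" using assms(1) finite_E finite_subset by blast
  have "indep_vars (\<lambda>_. borel) (\<lambda>e w. g e (X e w)) A"
    using assms(2) by (intro indep_vars_compose2[OF indep_vars_subset[OF indep_X assms(1)]]) auto
  from indep_vars_lebesgue_integral[OF A this assms(3)] indep_vars_integrable[OF A this assms(3)]
  show "expectation (\<lambda>w. \<Prod>e\<in>A. g e (X e w)) = (\<Prod>e\<in>A. expectation (\<lambda>w. g e (X e w)))"
    and "integrable M (\<lambda>w. \<Prod>e\<in>A. g e (X e w))"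
    by auto
qed

text \<open>An edge in both sets contributes the second moment \<open>s\<close>, an edge in exactly
  one of them the mean 1. The proof writes both products as one product over \<open>E\<close> with
  exponents 0, 1 or 2 and uses independence once.\<close>

lemma
  assumes "\<pi> \<subseteq> E" "\<pi>' \<subseteq> E"
  shows expectation_prod_prod: "expectation (\<lambda>w. (\<Prod>e\<in>\<pi>. X e w) * (\<Prod>e\<in>\<pi>'. X e w)) = s ^ card (\<pi> \<inter> \<pi>')"
    and integrable_prod_prod: "integrable M (\<lambda>w. (\<Prod>e\<in>\<pi>. X e w) * (\<Prod>e\<in>\<pi>'. X e w))"
proof -
  let ?k = "\<lambda>e. (if e \<in> \<pi> then 1 else 0) + (if e \<in> \<pi>' then 1 else (0::nat))"
  have *: "(\<Prod>e\<in>A. X e w) = (\<Prod>e\<in>E. X e w ^ (if e \<in> A then 1 else 0))" if "A \<subseteq> E" for A w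
    using that finite_E by (simp add: if_distrib prod.If_cases Int_absorb1 cong: if_cong)
  have eq: "(\<Prod>e\<in>\<pi>. X e w) * (\<Prod>e\<in>\<pi>'. X e w) = (\<Prod>e\<in>E. X e w ^ ?k e)" for w
    using assms by (simp add: * power_add prod.distrib)
  have "expectation (\<lambda>w. \<Prod>e\<in>E. X e w ^ ?k e) = (\<Prod>e\<in>E. expectation (\<lambda>w. X e w ^ ?k e))"
    by (rule expectation_prod[of E "\<lambda>e x. x ^ ?k e"]) (auto simp: X_integrable)
  also have "\<dots> = (\<Prod>e\<in>E. if e \<in> \<pi> \<inter> \<pi>' then s else 1)"
    by (intro prod.cong refl)
       (auto simp: X_mean X_second prob_space power2_eq_square[symmetric] numeral_2_eq_2[symmetric])
  also have "\<dots> = s ^ card (\<pi> \<inter> \<pi>')"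
    using assms finite_E by (simp only: prod.If_cases Collect_mem_eq) (simp add: Int_absorb1 le_infI1)
  finally show "expectation (\<lambda>w. (\<Prod>e\<in>\<pi>. X e w) * (\<Prod>e\<in>\<pi>'. X e w)) = s ^ card (\<pi> \<inter> \<pi>')"
    unfolding eq .
  show "integrable M (\<lambda>w. (\<Prod>e\<in>\<pi>. X e w) * (\<Prod>e\<in>\<pi>'. X e w))"
    unfolding eq by (rule integrable_prod[of E "\<lambda>e x. x ^ ?k e"]) (auto simp: X_integrable)
qed

text \<open>Averaging over the weights gives a factor \<open>s\<close> for each common edge, so the
  random form with base \<open>v\<close> turns into the deterministic pairing with base
  \<open>v * s\<close>.\<close>

lemma
  shows integrable_overlap_form: "integrable M (\<lambda>w. overlap_form E a (\<lambda>e. X e w) f)"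
    and expectation_overlap_form_power:
      "expectation (\<lambda>w. overlap_form E a (\<lambda>e. X e w) (\<lambda>k. v ^ k)) = overlap_pairing E a a (v * s)"
proof -
  have eq: "overlap_form E a (\<lambda>e. X e w) f = (\<Sum>\<pi>\<in>Pow E. \<Sum>\<pi>'\<in>Pow E.
      (f (card (\<pi> \<inter> \<pi>')) * (a \<pi> * a \<pi>')) * ((\<Prod>e\<in>\<pi>. X e w) * (\<Prod>e\<in>\<pi>'. X e w)))" for f w
    unfolding overlap_form_def by (simp add: mult_ac)
  have int: "integrable M (\<lambda>w. C * ((\<Prod>e\<in>\<pi>. X e w) * (\<Prod>e\<in>\<pi>'. X e w)))"
    if "\<pi> \<in> Pow E" "\<pi>' \<in> Pow E" for C \<pi> \<pi>'
    using that by (intro integrable_mult_right integrable_prod_prod) auto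
  show "integrable M (\<lambda>w. overlap_form E a (\<lambda>e. X e w) f)"
    unfolding eq by (intro Bochner_Integration.integrable_sum int)
  have "expectation (\<lambda>w. overlap_form E a (\<lambda>e. X e w) (\<lambda>k. v ^ k)) =
    (\<Sum>\<pi>\<in>Pow E. \<Sum>\<pi>'\<in>Pow E. expectation (\<lambda>w.
      (v ^ card (\<pi> \<inter> \<pi>') * (a \<pi> * a \<pi>')) * ((\<Prod>e\<in>\<pi>. X e w) * (\<Prod>e\<in>\<pi>'. X e w))))"
    unfolding eq
    by (subst Bochner_Integration.integral_sum, intro Bochner_Integration.integrable_sum int, assumption+)
       (intro sum.cong refl Bochner_Integration.integral_sum int, assumption+)
  also have "\<dots> = overlap_pairing E a a (v * s)"
    unfolding overlap_pairing_def integral_mult_right_zero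
    by (intro sum.cong refl) (simp add: expectation_prod_prod power_mult_distrib)
  finally show "expectation (\<lambda>w. overlap_form E a (\<lambda>e. X e w) (\<lambda>k. v ^ k)) = overlap_pairing E a a (v * s)" .
qed

lemma overlap_defect_measurable [measurable]:
  "(\<lambda>w. overlap_defect E a b (\<lambda>e. X e w)) \<in> borel_measurable M"
proof -
  have "(\<lambda>w. above E a (\<lambda>e. X e w) \<Gamma>) \<in> borel_measurable M" for a \<Gamma>
    unfolding above_def
    by (intro borel_measurable_sum borel_measurable_times borel_measurable_prod borel_measurable_const X_measurable) auto
  then show ?thesis unfolding overlap_defect_def by measurable
qed

lemma overlap_defect_nonneg: "overlap_defect E a b x \<ge> 0"
  unfolding overlap_defect_def by (intro sum_nonneg) auto

text \<open>In expectation the forms with base 3 become pairings with base \<open>3 * s\<close>. The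
  numerator over \<open>2 * k\<close> is the pairing of \<open>a - b\<close> with itself, expanded
  by bilinearity.\<close>

lemma
  shows integrable_overlap_defect: "integrable M (\<lambda>w. overlap_defect E a b (\<lambda>e. X e w))"
    and expectation_overlap_defect_le: "k > 0 \<Longrightarrow> expectation (\<lambda>w. overlap_defect E a b (\<lambda>e. X e w)) \<le>
      (overlap_pairing E a a (3 * s) - 2 * overlap_pairing E a b (3 * s) + overlap_pairing E b b (3 * s)) / (2 * k)
      + k * (overlap_pairing E a a (3 * s) + overlap_pairing E b b (3 * s))"
proof -
  let ?q = "\<lambda>a w. overlap_form E a (\<lambda>e. X e w) (\<lambda>j. 3 ^ j)"
  let ?u = "\<lambda>k w. ?q (\<lambda>\<pi>. a \<pi> - b \<pi>) w / (2 * k) + k * (?q a w + ?q b w)"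
  have u: "integrable M (?u k)" for k
    by (intro Bochner_Integration.integrable_add integrable_divide integrable_mult_right integrable_overlap_form)
  have le: "overlap_defect E a b (\<lambda>e. X e w) \<le> ?u k w" if "k > 0" for k w
    by (rule overlap_defect_le[OF finite_E that])
  show int: "integrable M (\<lambda>w. overlap_defect E a b (\<lambda>e. X e w))"
    by (rule Bochner_Integration.integrable_bound[OF u[of 1]])
       (use le[of 1] in \<open>auto simp: overlap_defect_nonneg intro!: always_eventually order.trans[OF _ abs_ge_self]\<close>)
  assume "k > 0"
  then have "expectation (\<lambda>w. overlap_defect E a b (\<lambda>e. X e w)) \<le> expectation (?u k)"
    by (intro integral_mono int u le)
  also have "expectation (?u k) = 
      (overlap_pairing E a a (3 * s) - 2 * overlap_pairing E a b (3 * s) + overlap_pairing E b b (3 * s)) / (2 * k)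
      + k * (overlap_pairing E a a (3 * s) + overlap_pairing E b b (3 * s))"
    by (simp add: integrable_overlap_form expectation_overlap_form_power overlap_pairing_diff)
  finally show "expectation (\<lambda>w. overlap_defect E a b (\<lambda>e. X e w)) \<le> \<dots>" .
qed

lemma X_integrable' [simp]: "e \<in> E \<Longrightarrow> integrable M (X e)"
  using X_integrable[of e 1] by simp

text \<open>The variance is nonnegative. This later ensures that \<open>3 * s\<close> is an
  admissible base \<open>u \<ge> 1\<close>.\<close>

lemma second_moment_ge_1:
  assumes "E \<noteq> {}"
  shows "s \<ge> 1"
proof -
  from assms obtain e where e: "e \<in> E" by auto
  have "0 \<le> expectation (\<lambda>w. (X e w - 1)\<^sup>2)" by simp
  also have "(\<lambda>w. (X e w - 1)\<^sup>2) = (\<lambda>w. (X e w)\<^sup>2 - 2 * X e w + 1)"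
    by (simp add: power2_diff fun_eq_iff)
  also have "expectation \<dots> = s - 1"
    using e X_integrable[OF e, of 2] by (simp add: X_mean X_second prob_space)
  finally show ?thesis by simp
qed

text \<open>Negative moments are what keeps the partition function away from 0.\<close>

lemma
  assumes "0 \<le> p" "p \<le> 1 / 2"
  shows integrable_inverse_prod: "integrable M (\<lambda>w. 1 / (\<Prod>e\<in>E. 1 - p + p * X e w))"
    and expectation_inverse_prod_le:
      "expectation (\<lambda>w. 1 / (\<Prod>e\<in>E. 1 - p + p * X e w)) \<le> exp (2 * p\<^sup>2 * (s - 1) * real (card E))"
proof -
  let ?g = "\<lambda>x::real. 1 / (1 - p + p * x)"
  have eq: "1 / (\<Prod>e\<in>E. 1 - p + p * X e w) = (\<Prod>e\<in>E. ?g (X e w))" for w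
    by (simp add: prod_dividef)
  have d: "1 - p + p * X e w \<ge> 1 / 2" if "e \<in> E" for e w
    using assms mult_nonneg_nonneg[OF assms(1) X_nonneg[OF that, of w]] by linarith
  have int: "integrable M (\<lambda>w. ?g (X e w))" if e: "e \<in> E" for e
  proof (rule integrable_const_bound[of _ 2])
    show "AE w in M. norm (?g (X e w)) \<le> 2"
    proof (rule always_eventually, rule allI)
      fix w show "norm (?g (X e w)) \<le> 2"
        using d[OF e, of w] by (simp add: divide_le_eq)
    qed
  qed (use e in measurable)
  show "integrable M (\<lambda>w. 1 / (\<Prod>e\<in>E. 1 - p + p * X e w))"
    unfolding eq by (intro integrable_prod int) auto
  have "expectation (\<lambda>w. 1 / (\<Prod>e\<in>E. 1 - p + p * X e w)) = (\<Prod>e\<in>E. expectation (\<lambda>w. ?g (X e w)))"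
    unfolding eq by (intro expectation_prod int) auto
  also have "\<dots> \<le> (\<Prod>e\<in>E. exp (2 * p\<^sup>2 * (s - 1)))"
  proof (intro prod_mono conjI)
    fix e assume e: "e \<in> E"
    show "0 \<le> expectation (\<lambda>w. ?g (X e w))"
    proof (intro Bochner_Integration.integral_nonneg)
      fix w show "0 \<le> ?g (X e w)" using d[OF e, of w] by simp
    qed
    \<comment> \<open>The majorant is the bound for \<open>1 / (1 + v)\<close> at
      \<open>v = p * X e w - p\<close>, expanded in powers of \<open>X e w\<close>.\<close>
    have "expectation (\<lambda>w. ?g (X e w))
        \<le> expectation (\<lambda>w. (1 + p + 2 * p\<^sup>2) - (p + 4 * p\<^sup>2) * X e w + 2 * p\<^sup>2 * (X e w)\<^sup>2)"
    proof (intro integral_mono int e)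
      show "integrable M (\<lambda>w. (1 + p + 2 * p\<^sup>2) - (p + 4 * p\<^sup>2) * X e w + 2 * p\<^sup>2 * (X e w)\<^sup>2)"
        using e X_integrable[OF e, of 2] by simp
      fix w
      show "?g (X e w) \<le> (1 + p + 2 * p\<^sup>2) - (p + 4 * p\<^sup>2) * X e w + 2 * p\<^sup>2 * (X e w)\<^sup>2"
        using inverse_one_plus_le[of "p * X e w - p"] d[OF e, of w]
        by (simp add: algebra_simps power2_eq_square)
    qed
    also have "\<dots> = 1 + 2 * p\<^sup>2 * (s - 1)"
      using e X_integrable[OF e, of 2] by (simp add: X_mean X_second prob_space algebra_simps)
    also have "\<dots> \<le> exp (2 * p\<^sup>2 * (s - 1))" by (rule exp_ge_add_one_self)
    finally show "expectation (\<lambda>w. ?g (X e w)) \<le> exp (2 * p\<^sup>2 * (s - 1))" .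
  qed
  also have "\<dots> = exp (2 * p\<^sup>2 * (s - 1) * real (card E))"
    by (simp add: exp_of_nat_mult[symmetric] mult_ac)
  finally show "expectation (\<lambda>w. 1 / (\<Prod>e\<in>E. 1 - p + p * X e w)) \<le> exp (2 * p\<^sup>2 * (s - 1) * real (card E))" .
qed


text \<open>A quantitative law of large numbers. The centred squares are independent, so only
  diagonal terms contribute to the second moment of their sum. The inequality \<open>amgm\<close> at
  \<open>sqrt (real (card E))\<close> then bounds the first absolute moment.\<close>

lemma
  assumes "E \<noteq> {}"
  shows integrable_abs_sum_squares: "integrable M (\<lambda>w. \<bar>\<Sum>e\<in>E. (X e w)\<^sup>2 - s\<bar>)"
    and expectation_abs_sum_squares_le:
      "expectation (\<lambda>w. \<bar>\<Sum>e\<in>E. (X e w)\<^sup>2 - s\<bar>) \<le> (1 + c) * sqrt (real (card E)) / 2"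
proof -
  let ?t = "\<lambda>w. \<Sum>e\<in>E. (X e w)\<^sup>2 - s" and ?k = "sqrt (real (card E))"
  let ?z = "\<lambda>e w. (X e w)\<^sup>2 - s"
  have z: "integrable M (?z e)" "expectation (?z e) = 0" if "e \<in> E" for e
    using X_integrable[OF that, of 2] that by (auto simp: X_second prob_space)
  have zz: "integrable M (\<lambda>w. ?z e w * ?z f w)"
    "expectation (\<lambda>w. ?z e w * ?z f w) \<le> (if e = f then c else 0)" if ef: "e \<in> E" "f \<in> E" for e f
  proof -
    show "integrable M (\<lambda>w. ?z e w * ?z f w)"
    proof (cases "e = f")
      case False
      then show ?thesis
        using integrable_prod[of "{e, f}" "\<lambda>_ x. x\<^sup>2 - s"] ef z(1) by auto
    next
      case True
      have "?z e w * ?z e w = X e w ^ 4 - 2 * s * (X e w)\<^sup>2 + s\<^sup>2" for w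
        by (simp add: algebra_simps power2_eq_square power4_eq_xxxx)
      then show ?thesis using True ef X_integrable[of e 2] X_integrable[of e 4] by simp
    qed
    show "expectation (\<lambda>w. ?z e w * ?z f w) \<le> (if e = f then c else 0)"
    proof (cases "e = f")
      case False
      then have "expectation (\<lambda>w. ?z e w * ?z f w) = 0"
        using expectation_prod[of "{e, f}" "\<lambda>_ x. x\<^sup>2 - s"] ef z by auto
      then show ?thesis using False by simp
    next
      case True
      have "?z e w * ?z e w = X e w ^ 4 - 2 * s * (X e w)\<^sup>2 + s\<^sup>2" for w
        by (simp add: algebra_simps power2_eq_square power4_eq_xxxx)
      then have "expectation (\<lambda>w. ?z e w * ?z e w) = expectation (\<lambda>w. X e w ^ 4) - s\<^sup>2"
        using True ef X_integrable[of e 2] X_integrable[of e 4]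
        by (simp add: X_second prob_space) (simp add: power2_eq_square)
      then show ?thesis using True X_fourth[OF ef(1)] by (simp add: diff_le_eq add_increasing2)
    qed
  qed
  have sq: "(?t w)\<^sup>2 = (\<Sum>e\<in>E. \<Sum>f\<in>E. ?z e w * ?z f w)" for w
    by (simp add: power2_eq_square sum_product)
  have int2: "integrable M (\<lambda>w. (?t w)\<^sup>2)"
    unfolding sq by (intro Bochner_Integration.integrable_sum zz)
  have "expectation (\<lambda>w. (?t w)\<^sup>2) = (\<Sum>e\<in>E. \<Sum>f\<in>E. expectation (\<lambda>w. ?z e w * ?z f w))"
    unfolding sq
    by (subst Bochner_Integration.integral_sum, intro Bochner_Integration.integrable_sum zz, assumption+)
       (intro sum.cong refl Bochner_Integration.integral_sum zz, assumption+)
  also have "\<dots> \<le> (\<Sum>e\<in>E. \<Sum>f\<in>E. if e = f then c else 0)"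
    by (intro sum_mono zz)
  also have "\<dots> = c * real (card E)" using finite_E by (simp add: sum.delta)
  finally have t2: "expectation (\<lambda>w. (?t w)\<^sup>2) \<le> c * real (card E)" .
  show int: "integrable M (\<lambda>w. \<bar>?t w\<bar>)"
    by (intro integrable_abs Bochner_Integration.integrable_sum z)
  have k: "?k > 0" using assms finite_E by (simp add: card_gt_0_iff)
  have amgm: "\<bar>t\<bar> \<le> (k + t\<^sup>2 / k) / 2" if "k > 0" for t k :: real
  proof -
    have "0 \<le> (k - \<bar>t\<bar>)\<^sup>2" by simp
    then have "2 * \<bar>t\<bar> * k \<le> k * k + t\<^sup>2" by (simp add: power2_diff power2_eq_square algebra_simps)
    then show ?thesis using that by (simp add: field_simps)
  qed
  have "expectation (\<lambda>w. \<bar>?t w\<bar>) \<le> expectation (\<lambda>w. (?k + (?t w)\<^sup>2 / ?k) / 2)"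
    using int2 by (intro integral_mono int amgm[OF k]) auto
  also have "\<dots> = (?k + expectation (\<lambda>w. (?t w)\<^sup>2) / ?k) / 2"
    using int2 by (simp add: prob_space)
  also have "\<dots> \<le> (?k + c * real (card E) / ?k) / 2"
    using t2 k by (intro divide_right_mono add_left_mono) auto
  also have "\<dots> = (1 + c) * ?k / 2"
    by (simp add: real_div_sqrt algebra_simps flip: times_divide_eq_right)
  finally show "expectation (\<lambda>w. \<bar>?t w\<bar>) \<le> (1 + c) * sqrt (real (card E)) / 2" .
qed

section \<open>Distance of the tilted trials from the Poisson law\<close>

definition poisson_defect :: "real \<Rightarrow> real \<Rightarrow> 'w \<Rightarrow> real" where
  "poisson_defect p l w = \<bar>(\<Sum>e\<in>E. (p * X e w / (1 - p + p * X e w))\<^sup>2) - l\<bar>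
    + (\<Sum>e\<in>E. ((p * X e w / (1 - p + p * X e w))\<^sup>2)\<^sup>2)"

lemma poisson_defect_nonneg: "poisson_defect p l w \<ge> 0"
  unfolding poisson_defect_def by (intro add_nonneg_nonneg sum_nonneg) auto

text \<open>The defect adds the error in the rate to the error in Le Cam's inequality. All terms of
  the bound are small when \<open>p\<close> is small, \<open>card E\<close> is large and
  \<open>p^2 * s * card E\<close> is close to \<open>l\<close>.\<close>

lemma
  assumes "0 \<le> p" "p \<le> 1 / 2" "E \<noteq> {}"
  shows integrable_poisson_defect: "integrable M (poisson_defect p l)"
    and expectation_poisson_defect_le: "expectation (poisson_defect p l) \<le>
      p\<^sup>2 * ((1 + c) * sqrt (real (card E)) / 2) + \<bar>p\<^sup>2 * s * real (card E) - l\<bar>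
      + 6 * p ^ 3 * ((2 * s + c) * real (card E)) + 16 * p ^ 4 * (c * real (card E))"
proof -
  \<comment> \<open>In order: fluctuation of the squares, bias of the rate, replacement of the
    tilted probabilities by \<open>p^2 * x^2\<close>, and the Le Cam term.\<close>
  let ?b = "\<lambda>w. p\<^sup>2 * \<bar>\<Sum>e\<in>E. (X e w)\<^sup>2 - s\<bar> + \<bar>p\<^sup>2 * s * real (card E) - l\<bar>
    + 6 * p ^ 3 * (\<Sum>e\<in>E. 2 * (X e w)\<^sup>2 + X e w ^ 4) + 16 * p ^ 4 * (\<Sum>e\<in>E. X e w ^ 4)"
  have int2: "integrable M (\<lambda>w. \<Sum>e\<in>E. 2 * (X e w)\<^sup>2 + X e w ^ 4)"
    and int4: "integrable M (\<lambda>w. \<Sum>e\<in>E. X e w ^ 4)"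
    by (auto intro!: Bochner_Integration.integrable_sum Bochner_Integration.integrable_add X_integrable)
  have b: "integrable M ?b"
    by (intro Bochner_Integration.integrable_add integrable_mult_right integrable_abs_sum_squares assms int2 int4)
       simp
  have le: "poisson_defect p l w \<le> ?b w" for w
  proof -
    let ?y = "\<lambda>e. (p * X e w / (1 - p + p * X e w))\<^sup>2"
    have "\<bar>sum ?y E - (\<Sum>e\<in>E. p\<^sup>2 * (X e w)\<^sup>2)\<bar> \<le> (\<Sum>e\<in>E. \<bar>?y e - p\<^sup>2 * (X e w)\<^sup>2\<bar>)"
      unfolding sum_subtractf[symmetric] by (rule sum_abs)
    also have "\<dots> \<le> (\<Sum>e\<in>E. 6 * p ^ 3 * (2 * (X e w)\<^sup>2 + X e w ^ 4))"
      by (intro sum_mono tilted_square_approx assms X_nonneg)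
    finally have 1: "\<bar>sum ?y E - (\<Sum>e\<in>E. p\<^sup>2 * (X e w)\<^sup>2)\<bar> \<le> 6 * p ^ 3 * (\<Sum>e\<in>E. 2 * (X e w)\<^sup>2 + X e w ^ 4)"
      by (simp only: sum_distrib_left)
    have 2: "(\<Sum>e\<in>E. p\<^sup>2 * (X e w)\<^sup>2) = p\<^sup>2 * (\<Sum>e\<in>E. (X e w)\<^sup>2 - s) + p\<^sup>2 * s * real (card E)"
      by (simp add: sum_subtractf sum_distrib_left[symmetric] algebra_simps)
    have 3: "\<bar>p\<^sup>2 * (\<Sum>e\<in>E. (X e w)\<^sup>2 - s)\<bar> = p\<^sup>2 * \<bar>\<Sum>e\<in>E. (X e w)\<^sup>2 - s\<bar>"
      by (simp add: abs_mult)
    have 4: "(\<Sum>e\<in>E. (?y e)\<^sup>2) \<le> 16 * p ^ 4 * (\<Sum>e\<in>E. X e w ^ 4)"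
      unfolding sum_distrib_left by (intro sum_mono tilted_square_approx assms X_nonneg)
    show ?thesis
      unfolding poisson_defect_def using 1 2 3 4 by linarith
  qed
  show int: "integrable M (poisson_defect p l)"
  proof (rule Bochner_Integration.integrable_bound[OF b])
    show "poisson_defect p l \<in> borel_measurable M"
      unfolding poisson_defect_def[abs_def] by measurable
    show "AE w in M. norm (poisson_defect p l w) \<le> norm (?b w)"
      using le poisson_defect_nonneg by (auto intro!: always_eventually order.trans[OF _ abs_ge_self])
  qed
  have "expectation (poisson_defect p l) \<le> expectation ?b"
    by (intro integral_mono int b le)
  also have "expectation ?b = p\<^sup>2 * expectation (\<lambda>w. \<bar>\<Sum>e\<in>E. (X e w)\<^sup>2 - s\<bar>) + \<bar>p\<^sup>2 * s * real (card E) - l\<bar>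
    + 6 * p ^ 3 * expectation (\<lambda>w. \<Sum>e\<in>E. 2 * (X e w)\<^sup>2 + X e w ^ 4) + 16 * p ^ 4 * expectation (\<lambda>w. \<Sum>e\<in>E. X e w ^ 4)"
    using int2 int4 integrable_abs_sum_squares[OF assms(3)] by (simp add: prob_space)
  also have "expectation (\<lambda>w. \<Sum>e\<in>E. 2 * (X e w)\<^sup>2 + X e w ^ 4) = (\<Sum>e\<in>E. 2 * s + expectation (\<lambda>w. X e w ^ 4))"
    by (subst Bochner_Integration.integral_sum) (auto simp: X_integrable X_second)
  also have "\<dots> \<le> (\<Sum>e\<in>E. 2 * s + c)"
    by (intro sum_mono add_left_mono X_fourth)
  also have "\<dots> = (2 * s + c) * real (card E)" by (simp add: algebra_simps)
  also have "expectation (\<lambda>w. \<Sum>e\<in>E. X e w ^ 4) = (\<Sum>e\<in>E. expectation (\<lambda>w. X e w ^ 4))"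
    by (subst Bochner_Integration.integral_sum) (auto simp: X_integrable)
  also have "\<dots> \<le> (\<Sum>e\<in>E. c)"
    by (intro sum_mono X_fourth)
  also have "(\<Sum>e\<in>E. c) = c * real (card E)" by simp
  also note expectation_abs_sum_squares_le[OF assms(3)]
  finally show "expectation (poisson_defect p l) \<le>
      p\<^sup>2 * ((1 + c) * sqrt (real (card E)) / 2) + \<bar>p\<^sup>2 * s * real (card E) - l\<bar>
      + 6 * p ^ 3 * ((2 * s + c) * real (card E)) + 16 * p ^ 4 * (c * real (card E))"
    using assms by (simp add: mult_left_mono)
qed

end

section \<open>Counting edge sets that are not matchings\<close>

text \<open>Given \<open>e\<close>, an edge \<open>f\<close> meeting it is determined by a shared
  endpoint (two choices) and its other endpoint (at most \<open>card V\<close> choices).\<close>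

lemma card_intersecting_pairs_le:
  assumes "finite_graph V E"
  shows "finite {(e, f) \<in> E \<times> E. e \<noteq> f \<and> e \<inter> f \<noteq> {}}"
    and "card {(e, f) \<in> E \<times> E. e \<noteq> f \<and> e \<inter> f \<noteq> {}} \<le> 2 * card V * card E"
proof -
  have V: "finite V" and E: "\<And>e. e \<in> E \<Longrightarrow> e \<subseteq> V \<and> card e = 2"
    using assms by (auto simp: finite_graph_def)
  have fE: "finite E" using E V finite_subset[of E "Pow V"] by auto
  let ?N = "\<lambda>e. (\<lambda>(w, v). (e, {w, v})) ` (e \<times> V)"
  have e: "finite e" if "e \<in> E" for e using E[OF that] V finite_subset by blast
  have sub: "{(e, f) \<in> E \<times> E. e \<noteq> f \<and> e \<inter> f \<noteq> {}} \<subseteq> (\<Union>e\<in>E. ?N e)"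
  proof
    fix q assume "q \<in> {(e, f) \<in> E \<times> E. e \<noteq> f \<and> e \<inter> f \<noteq> {}}"
    then obtain e f w where q: "q = (e, f)" and *: "e \<in> E" "f \<in> E" "w \<in> e" "w \<in> f" by auto
    from E[OF *(2)] have "card f = 2" by simp
    then obtain a b where "f = {a, b}" by (auto simp: card_2_iff)
    with *(4) obtain v where "f = {w, v}" by auto
    with * E[OF *(2)] show "q \<in> (\<Union>e\<in>E. ?N e)" unfolding q by force
  qed
  have fin: "finite (\<Union>e\<in>E. ?N e)" using fE e V by auto
  from sub fin show "finite {(e, f) \<in> E \<times> E. e \<noteq> f \<and> e \<inter> f \<noteq> {}}" by (rule finite_subset)
  have "card (?N e) \<le> 2 * card V" if "e \<in> E" for e
    using card_image_le[of "e \<times> V" "\<lambda>(w, v). (e, {w, v})"] e[OF that] V E[OF that]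
    by (simp add: card_cartesian_product)
  then have "(\<Sum>e\<in>E. card (?N e)) \<le> (\<Sum>e\<in>E. 2 * card V)"
    by (intro sum_mono)
  then have "card (\<Union>e\<in>E. ?N e) \<le> card E * (2 * card V)"
    using card_UN_le[OF fE, of ?N] by simp
  then show "card {(e, f) \<in> E \<times> E. e \<noteq> f \<and> e \<inter> f \<noteq> {}} \<le> 2 * card V * card E"
    using card_mono[OF fin sub] by (simp add: mult_ac)
qed

lemma sum_power_card_Pow:
  assumes "finite E"
  shows "(\<Sum>\<Gamma>\<in>Pow E. z ^ card \<Gamma>) = (1 + z :: real) ^ card E"
  using sum_newton_card[OF assms, of "\<lambda>k. (1 + z) ^ k"] by (simp add: newton_power)

text \<open>The two prescribed edges give the factor \<open>z^2\<close>, and the rest of \<Gamma> is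
  a free subset of the remaining edges.\<close>

lemma sum_power_card_supersets_le:
  fixes z :: real
  assumes "finite E" "z \<ge> 0" "e \<in> E" "f \<in> E" "e \<noteq> f"
  shows "(\<Sum>\<Gamma> | \<Gamma> \<in> Pow E \<and> e \<in> \<Gamma> \<and> f \<in> \<Gamma>. z ^ card \<Gamma>) \<le> z\<^sup>2 * (1 + z) ^ card E"
proof -
  let ?i = "\<lambda>\<Gamma>. insert e (insert f \<Gamma>)" and ?E = "E - {e, f}"
  have fin: "finite ?E" using assms(1) by simp
  have img: "{\<Gamma>. \<Gamma> \<in> Pow E \<and> e \<in> \<Gamma> \<and> f \<in> \<Gamma>} = ?i ` Pow ?E"
  proof (intro equalityI subsetI)
    fix \<Gamma> assume "\<Gamma> \<in> {\<Gamma>. \<Gamma> \<in> Pow E \<and> e \<in> \<Gamma> \<and> f \<in> \<Gamma>}"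
    then have "\<Gamma> = ?i (\<Gamma> - {e, f})" "\<Gamma> - {e, f} \<in> Pow ?E" by auto
    then show "\<Gamma> \<in> ?i ` Pow ?E" by blast
  qed (use assms in auto)
  have inj: "inj_on ?i (Pow ?E)"
    using assms(5) by (intro inj_onI) (auto simp: set_eq_iff)
  have "(\<Sum>\<Gamma> | \<Gamma> \<in> Pow E \<and> e \<in> \<Gamma> \<and> f \<in> \<Gamma>. z ^ card \<Gamma>) = (\<Sum>\<Gamma>\<in>Pow ?E. z ^ card (?i \<Gamma>))"
    unfolding img by (simp add: sum.reindex[OF inj])
  also have "\<dots> = (\<Sum>\<Gamma>\<in>Pow ?E. z\<^sup>2 * z ^ card \<Gamma>)"
  proof (rule sum.cong)
    fix \<Gamma> assume "\<Gamma> \<in> Pow ?E"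
    then have "finite \<Gamma>" "e \<notin> \<Gamma>" "f \<notin> \<Gamma>" using fin finite_subset by auto
    then show "z ^ card (?i \<Gamma>) = z\<^sup>2 * z ^ card \<Gamma>" using assms(5) by (simp add: power2_eq_square)
  qed simp
  also have "\<dots> = z\<^sup>2 * (1 + z) ^ card ?E"
    by (simp add: sum_distrib_left[symmetric] sum_power_card_Pow[OF fin])
  also have "\<dots> \<le> z\<^sup>2 * (1 + z) ^ card E"
    using assms by (intro mult_left_mono power_increasing card_mono) auto
  finally show ?thesis .
qed

text \<open>A union bound over ordered pairs of distinct intersecting edges. For \<open>z\<close> of
  order \<open>1 / card E\<close> the bound has order \<open>card V / card E\<close>, which vanishes
  for dense graphs.\<close>

lemma sum_nonmatching_le:
  fixes z :: real
  assumes "finite_graph V E" "z \<ge> 0"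
  shows "(\<Sum>\<Gamma> | \<Gamma> \<in> Pow E \<and> \<not> partial_matching E \<Gamma>. z ^ card \<Gamma>)
    \<le> 2 * real (card V) * real (card E) * (z\<^sup>2 * (1 + z) ^ card E)"
proof -
  let ?P = "{(e, f) \<in> E \<times> E. e \<noteq> f \<and> e \<inter> f \<noteq> {}}"
  have fE: "finite E"
    using assms(1) finite_subset[of E "Pow V"] by (auto simp: finite_graph_def)
  have finP: "finite ?P" by (rule card_intersecting_pairs_le(1)[OF assms(1)])
  have "(\<Sum>\<Gamma> | \<Gamma> \<in> Pow E \<and> \<not> partial_matching E \<Gamma>. z ^ card \<Gamma>)
      \<le> (\<Sum>\<Gamma> | \<Gamma> \<in> Pow E \<and> \<not> partial_matching E \<Gamma>.
        \<Sum>q\<in>?P. if fst q \<in> \<Gamma> \<and> snd q \<in> \<Gamma> then z ^ card \<Gamma> else 0)"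
  proof (intro sum_mono)
    fix \<Gamma> assume "\<Gamma> \<in> {\<Gamma>. \<Gamma> \<in> Pow E \<and> \<not> partial_matching E \<Gamma>}"
    then obtain e f where ef: "(e, f) \<in> ?P" "e \<in> \<Gamma>" "f \<in> \<Gamma>"
      unfolding partial_matching_def pairwise_def disjnt_def by blast
    then show "z ^ card \<Gamma> \<le> (\<Sum>q\<in>?P. if fst q \<in> \<Gamma> \<and> snd q \<in> \<Gamma> then z ^ card \<Gamma> else 0)"
      using member_le_sum[OF ef(1) _ finP, of "\<lambda>q. if fst q \<in> \<Gamma> \<and> snd q \<in> \<Gamma> then z ^ card \<Gamma> else 0"]
        assms(2) by simp
  qed
  also have "\<dots> \<le> (\<Sum>\<Gamma>\<in>Pow E. \<Sum>q\<in>?P. if fst q \<in> \<Gamma> \<and> snd q \<in> \<Gamma> then z ^ card \<Gamma> else 0)"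
    using fE assms(2) by (intro sum_mono2 sum_nonneg) auto
  also have "\<dots> = (\<Sum>q\<in>?P. \<Sum>\<Gamma>\<in>Pow E. if fst q \<in> \<Gamma> \<and> snd q \<in> \<Gamma> then z ^ card \<Gamma> else 0)"
    by (rule sum.swap)
  also have "\<dots> = (\<Sum>q\<in>?P. \<Sum>\<Gamma> | \<Gamma> \<in> Pow E \<and> fst q \<in> \<Gamma> \<and> snd q \<in> \<Gamma>. z ^ card \<Gamma>)"
    using fE by (intro sum.cong refl sum.mono_neutral_cong_right) auto
  also have "\<dots> \<le> (\<Sum>q\<in>?P. z\<^sup>2 * (1 + z) ^ card E)"
    by (intro sum_mono sum_power_card_supersets_le fE assms) auto
  also have "\<dots> = real (card ?P) * (z\<^sup>2 * (1 + z) ^ card E)" by simp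
  also have "\<dots> \<le> real (2 * card V * card E) * (z\<^sup>2 * (1 + z) ^ card E)"
    using card_intersecting_pairs_le(2)[OF assms(1)] assms(2)
    by (intro mult_right_mono) (auto simp only: of_nat_le_iff intro!: mult_nonneg_nonneg zero_le_power)
  finally show ?thesis by simp
qed

text \<open>In the expansion over \<Gamma>, matchings contribute at most the squared percolation
  probability times \<open>(1 + r ^ k * d)^2\<close> with \<open>k = card \<Gamma>\<close>, which
  splits into three geometric terms. The other \<Gamma> are handled by the union bound. In the
  application, \<open>d\<close> is \<open>1 / sqrt m\<close>.\<close>

lemma overlap_pairing_uniform_le:
  assumes graph: "finite_graph V E" and S: "S \<subseteq> Pow E" "S \<noteq> {}" and u: "u \<ge> 1"
    and p: "p > 0" "\<And>e. e \<in> E \<Longrightarrow> prob_contains S {e} = p" and d: "d \<ge> 0"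
    and matching: "\<And>\<Gamma>. partial_matching E \<Gamma> \<Longrightarrow>
      \<bar>prob_contains S \<Gamma> / (\<Prod>e\<in>\<Gamma>. prob_contains S {e}) - 1\<bar> \<le> r ^ card \<Gamma> * d"
    and nonmatching: "\<And>\<Gamma>. (\<exists>\<pi>\<in>S. \<Gamma> \<subseteq> \<pi>) \<Longrightarrow> \<not> partial_matching E \<Gamma> \<Longrightarrow>
      prob_contains S \<Gamma> \<le> r' ^ card \<Gamma> * (\<Prod>e\<in>\<Gamma>. prob_contains S {e})"
    and r: "r > 0" "r' > 0"
  shows "overlap_pairing E (uniform S) (uniform S) u \<le>
    exp ((u - 1) * (p\<^sup>2 * card E)) + 2 * d * exp ((u - 1) * r * (p\<^sup>2 * card E))
    + d\<^sup>2 * exp ((u - 1) * r\<^sup>2 * (p\<^sup>2 * card E))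
    + 2 * ((u - 1) * r'\<^sup>2)\<^sup>2 * (real (card V) / real (card E)) * (p\<^sup>2 * card E)\<^sup>2
      * exp ((u - 1) * r'\<^sup>2 * (p\<^sup>2 * card E))"
proof -
  have fE: "finite E"
    using graph finite_subset[of E "Pow V"] by (auto simp: finite_graph_def)
  have fS: "finite S" using S(1) fE finite_subset by blast
  let ?x = "(u - 1) * p\<^sup>2" and ?z = "(u - 1) * p\<^sup>2 * r'\<^sup>2"
  let ?P = "prob_contains S"
  have prod: "(\<Prod>e\<in>\<Gamma>. ?P {e}) = p ^ card \<Gamma>" if "\<Gamma> \<subseteq> E" for \<Gamma>
  proof -
    have "(\<Prod>e\<in>\<Gamma>. ?P {e}) = (\<Prod>e\<in>\<Gamma>. p)" using that p(2) by (intro prod.cong) auto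
    then show ?thesis by simp
  qed
  have xz: "?x \<ge> 0" "?z \<ge> 0" using u by auto
  have expand: "v ^ k * (p ^ k * (1 + r ^ k * d))\<^sup>2 =
      (v * p\<^sup>2) ^ k + 2 * d * (v * p\<^sup>2 * r) ^ k + d\<^sup>2 * (v * p\<^sup>2 * r\<^sup>2) ^ k" for v k
    by (simp add: power_mult_distrib power2_eq_square algebra_simps)
  have bound: "(u - 1) ^ card \<Gamma> * (?P \<Gamma>)\<^sup>2 \<le>
      (?x ^ card \<Gamma> + 2 * d * (?x * r) ^ card \<Gamma> + d\<^sup>2 * (?x * r\<^sup>2) ^ card \<Gamma>)
      + (if partial_matching E \<Gamma> then 0 else ?z ^ card \<Gamma>)" if \<Gamma>: "\<Gamma> \<in> Pow E" for \<Gamma>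
  proof (cases "partial_matching E \<Gamma>")
    case True
    have "?P \<Gamma> / p ^ card \<Gamma> \<le> 1 + r ^ card \<Gamma> * d"
      using matching[OF True] \<Gamma> unfolding prod[OF PowD[OF \<Gamma>]] by (simp add: abs_le_iff)
    then have "?P \<Gamma> \<le> p ^ card \<Gamma> * (1 + r ^ card \<Gamma> * d)"
      using p(1) by (simp add: divide_le_eq mult.commute)
    then have "(u - 1) ^ card \<Gamma> * (?P \<Gamma>)\<^sup>2 \<le> (u - 1) ^ card \<Gamma> * (p ^ card \<Gamma> * (1 + r ^ card \<Gamma> * d))\<^sup>2"
      using u by (intro mult_left_mono power_mono) auto
    also have "\<dots> = ?x ^ card \<Gamma> + 2 * d * (?x * r) ^ card \<Gamma> + d\<^sup>2 * (?x * r\<^sup>2) ^ card \<Gamma>"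
      using expand[of "u - 1" "card \<Gamma>"] .
    finally show ?thesis using True by simp
  next
    case False
    have "?P \<Gamma> \<le> r' ^ card \<Gamma> * p ^ card \<Gamma>"
    \<comment> \<open>The hypothesis speaks only of sets contained in an element of
      \<open>S\<close>; for all others the containment probability is 0.\<close>
    proof (cases "\<exists>\<pi>\<in>S. \<Gamma> \<subseteq> \<pi>")
      case True
      then show ?thesis using nonmatching[OF True False] unfolding prod[OF PowD[OF \<Gamma>]] by simp
    next
      case False
      then have "S \<inter> {\<pi>. \<Gamma> \<subseteq> \<pi>} = {}" by auto
      then have "?P \<Gamma> = 0" using fS S(2) by (simp add: measure_pmf_of_set)
      then show ?thesis using r p(1) by simp
    qed
    then have "(u - 1) ^ card \<Gamma> * (?P \<Gamma>)\<^sup>2 \<le> (u - 1) ^ card \<Gamma> * (r' ^ card \<Gamma> * p ^ card \<Gamma>)\<^sup>2"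
      using u by (intro mult_left_mono power_mono) auto
    also have "\<dots> = ?z ^ card \<Gamma>"
      by (simp add: power_mult_distrib power2_eq_square)
    \<comment> \<open>The matching terms are nonnegative and are added here too, so that they can be
      summed in closed form over all subsets of \<open>E\<close>.\<close>
    also have "\<dots> \<le> (?x ^ card \<Gamma> + 2 * d * (?x * r) ^ card \<Gamma> + d\<^sup>2 * (?x * r\<^sup>2) ^ card \<Gamma>) + ?z ^ card \<Gamma>"
      using xz d r u p(1) by (intro add_increasing add_nonneg_nonneg mult_nonneg_nonneg zero_le_power) auto
    finally show ?thesis using False by simp
  qed
  have exp_bound: "(1 + y) ^ card E \<le> exp (real (card E) * y)" if "y \<ge> 0" for y :: real
    using power_mono[OF exp_ge_add_one_self[of y], of "card E"] that by (simp add: exp_of_nat_mult)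
  have "overlap_pairing E (uniform S) (uniform S) u
      \<le> (\<Sum>\<Gamma>\<in>Pow E. (?x ^ card \<Gamma> + 2 * d * (?x * r) ^ card \<Gamma> + d\<^sup>2 * (?x * r\<^sup>2) ^ card \<Gamma>)
      + (if partial_matching E \<Gamma> then 0 else ?z ^ card \<Gamma>))"
    unfolding overlap_pairing_uniform[OF fE S] by (intro sum_mono bound)
  also have "\<dots> = (1 + ?x) ^ card E + 2 * d * (1 + ?x * r) ^ card E + d\<^sup>2 * (1 + ?x * r\<^sup>2) ^ card E
      + (\<Sum>\<Gamma> | \<Gamma> \<in> Pow E \<and> \<not> partial_matching E \<Gamma>. ?z ^ card \<Gamma>)"
  proof -
    have "(\<Sum>\<Gamma>\<in>Pow E. if partial_matching E \<Gamma> then 0 else ?z ^ card \<Gamma>)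
        = (\<Sum>\<Gamma> | \<Gamma> \<in> Pow E \<and> \<not> partial_matching E \<Gamma>. ?z ^ card \<Gamma>)"
      using fE by (intro sum.mono_neutral_cong_right) auto
    then show ?thesis
      by (simp only: sum.distrib sum_distrib_left[symmetric] sum_power_card_Pow[OF fE])
  qed
  also have "\<dots> \<le> exp (card E * ?x) + 2 * d * exp (card E * (?x * r)) + d\<^sup>2 * exp (card E * (?x * r\<^sup>2))
      + 2 * real (card V) * real (card E) * (?z\<^sup>2 * exp (card E * ?z))"
    using xz d r u p(1)
    by (intro add_mono mult_left_mono exp_bound order.trans[OF sum_nonmatching_le[OF graph xz(2)]]) auto
  also have "2 * real (card V) * real (card E) * (?z\<^sup>2 * exp (card E * ?z))
     = 2 * ((u - 1) * r'\<^sup>2)\<^sup>2 * (real (card V) / real (card E)) * (p\<^sup>2 * card E)\<^sup>2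
      * exp ((u - 1) * r'\<^sup>2 * (p\<^sup>2 * card E))"
    by (cases "card E = 0") (simp_all add: power_mult_distrib power2_eq_square mult_ac)
  finally show ?thesis by (simp add: mult_ac)
qed

section \<open>Gibbs expectations\<close>

lemma boltzmann_nonneg: "boltzmann \<beta> x \<ge> 0"
  by (simp add: boltzmann_def)

lemma boltzmann_measurable [measurable]: "boltzmann \<beta> \<in> borel_measurable borel"
  unfolding boltzmann_def[abs_def] by measurable

text \<open>For \<open>k = 0\<close> this fails at infinite weight: the power is then 1, while
  \<open>boltzmann 0 \<infinity>\<close> is 0.\<close>

lemma boltzmann_power: "boltzmann \<beta> x ^ k = boltzmann (real k * \<beta>) x" if "k > 0"
  using that by (simp add: boltzmann_def zero_power exp_of_nat_mult[symmetric] mult_ac)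

lemma boltzmann_total_weight:
  assumes "finite \<pi>" "\<And>e. e \<in> \<pi> \<Longrightarrow> w e \<noteq> - \<infinity>"
  shows "boltzmann \<beta> (total_weight w \<pi>) = (\<Prod>e\<in>\<pi>. boltzmann \<beta> (w e))"
proof -
  \<comment> \<open>The induction must carry along that partial sums avoid
    \<open>- \<infinity>\<close>, since \<open>boltzmann\<close> is multiplicative only away from
    that value.\<close>
  have "(\<Sum>e\<in>\<pi>. w e) \<noteq> - \<infinity> \<and> boltzmann \<beta> (\<Sum>e\<in>\<pi>. w e) = (\<Prod>e\<in>\<pi>. boltzmann \<beta> (w e))"
    using assms
  proof (induction \<pi>)
    case empty
    then show ?case by (simp add: boltzmann_def)
  next
    case (insert e \<pi>)
    have add: "boltzmann \<beta> (a + b) = boltzmann \<beta> a * boltzmann \<beta> b" "a + b \<noteq> - \<infinity>"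
      if "a \<noteq> - \<infinity>" "b \<noteq> - \<infinity>" for a b
      using that by (cases a; cases b; simp add: boltzmann_def exp_add[symmetric] algebra_simps)+
    show ?case using insert add[of "w e" "\<Sum>e\<in>\<pi>. w e"] by simp
  qed
  then show ?thesis by (simp add: total_weight_def)
qed

lemma expectation_overlap_law:
  assumes "finite E" "S \<subseteq> Pow E" "S \<noteq> {}"
  shows "measure_pmf.expectation (overlap_law S \<beta> w) f =
    (\<Sum>\<pi>\<in>Pow E. \<Sum>\<pi>'\<in>Pow E. f (card (\<pi> \<inter> \<pi>')) * (pmf (gibbs S \<beta> w) \<pi> * pmf (gibbs S \<beta> w) \<pi>'))"
proof -
  have S: "finite S" using assms finite_subset by blast
  have set: "set_pmf (gibbs S \<beta> w) \<subseteq> Pow E"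
    using assms(2) by (auto simp: set_pmf_eq pmf_gibbs[OF S assms(3)] split: if_splits)
  have "measure_pmf.expectation (overlap_law S \<beta> w) f =
      measure_pmf.expectation (pair_pmf (gibbs S \<beta> w) (gibbs S \<beta> w)) (\<lambda>q. f (card (fst q \<inter> snd q)))"
    unfolding overlap_law_def by (simp add: case_prod_unfold)
  also have "\<dots> = (\<Sum>q\<in>Pow E \<times> Pow E. f (card (fst q \<inter> snd q)) * pmf (pair_pmf (gibbs S \<beta> w) (gibbs S \<beta> w)) q)"
    using assms(1) set by (intro integral_measure_pmf_real) auto
  also have "\<dots> = (\<Sum>\<pi>\<in>Pow E. \<Sum>\<pi>'\<in>Pow E. f (card (\<pi> \<inter> \<pi>')) * (pmf (gibbs S \<beta> w) \<pi> * pmf (gibbs S \<beta> w) \<pi>'))"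
    by (auto simp: sum.cartesian_product pmf_pair intro!: sum.cong)
  finally show ?thesis .
qed

text \<open>All elements of \<open>S\<close> have \<open>m\<close> edges, so normalising the weights
  changes every Boltzmann factor by the same \<open>L ^ m\<close>, which cancels in the Gibbs
  measure.\<close>

lemma expectation_overlap_law_eq:
  assumes "finite E" "S \<subseteq> Pow E" "S \<noteq> {}" "\<And>\<pi>. \<pi> \<in> S \<Longrightarrow> card \<pi> = m"
    and w: "\<And>e. e \<in> E \<Longrightarrow> w e \<noteq> - \<infinity>" and L: "L > 0"
    and x: "\<And>e. e \<in> E \<Longrightarrow> x e = boltzmann \<beta> (w e) / L"
    and N: "above E (uniform S) x {} \<noteq> 0"
  shows "measure_pmf.expectation (overlap_law S \<beta> w) f =
    overlap_form E (uniform S) x f / (above E (uniform S) x {})\<^sup>2"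
proof -
  let ?N = "above E (uniform S) x {}"
  have S: "finite S" using assms finite_subset by blast
  have b: "boltzmann \<beta> (total_weight w \<pi>) = L ^ m * prod x \<pi>" if "\<pi> \<in> S" for \<pi>
  proof -
    have \<pi>: "\<pi> \<subseteq> E" using that assms(2) by auto
    then have "finite \<pi>" using assms(1) by (rule finite_subset)
    note \<pi> = \<pi> this
    have "prod x \<pi> = (\<Prod>e\<in>\<pi>. boltzmann \<beta> (w e)) / L ^ card \<pi>"
      using \<pi> x by (subst prod.cong[OF refl, of _ x "\<lambda>e. boltzmann \<beta> (w e) / L"]) (auto simp: prod_dividef)
    moreover have "boltzmann \<beta> (total_weight w \<pi>) = (\<Prod>e\<in>\<pi>. boltzmann \<beta> (w e))"
      using \<pi> w by (intro boltzmann_total_weight) auto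
    ultimately show ?thesis using L assms(4)[OF that] by simp
  qed
  have "?N = (\<Sum>\<pi>\<in>S. prod x \<pi>) / real (card S)"
    using sum_uniform[OF assms(1,2)] by (simp add: above_def)
  then have Z: "partition_function S \<beta> w = L ^ m * ?N"
    by (simp add: partition_function_def b sum_distrib_left)
  have g: "pmf (gibbs S \<beta> w) \<pi> = uniform S \<pi> * prod x \<pi> / ?N" for \<pi>
    unfolding pmf_gibbs[OF S assms(3)] Z using L N b by (auto simp: uniform_def)
  show ?thesis
    unfolding expectation_overlap_law[OF assms(1-3)] overlap_form_def g
    by (simp add: sum_divide_distrib power2_eq_square)
qed

lemma expectation_overlap_law_measurable:
  fixes f :: "nat \<Rightarrow> real"
  assumes "finite E" "S \<subseteq> Pow E" "S \<noteq> {}" "\<And>e. e \<in> E \<Longrightarrow> w e \<in> borel_measurable M"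
  shows "(\<lambda>x. measure_pmf.expectation (overlap_law S \<beta> (\<lambda>e. w e x)) f) \<in> borel_measurable M"
proof -
  have S: "finite S" using assms finite_subset by blast
  have [measurable]: "(\<lambda>x. boltzmann \<beta> (total_weight (\<lambda>e. w e x) \<pi>)) \<in> borel_measurable M" if "\<pi> \<in> S" for \<pi>
  proof -
    have "(\<lambda>x. total_weight (\<lambda>e. w e x) \<pi>) \<in> borel_measurable M"
      unfolding total_weight_def using that assms(2,4) by (intro borel_measurable_ereal_sum) auto
    then show ?thesis by measurable
  qed
  have [measurable]: "(\<lambda>x. partition_function S \<beta> (\<lambda>e. w e x)) \<in> borel_measurable M"
    unfolding partition_function_def by measurable
  have [measurable]: "(\<lambda>x. pmf (gibbs S \<beta> (\<lambda>e. w e x)) \<pi>) \<in> borel_measurable M" for \<pi>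
    unfolding pmf_gibbs[OF S assms(3)] by (cases "\<pi> \<in> S") (simp_all, measurable)
  show ?thesis unfolding expectation_overlap_law[OF assms(1-3)] by measurable
qed

text \<open>The deterministic core: with both defects small, numerator and denominator are close to
  their percolation counterparts relative to the squared percolation partition function. The
  numerator error is at most \<open>4 * B * \<eta>\<close> times that square, and the denominator is
  at least half of it; hence the factor 8.\<close>

lemma (in iid_factors) overlap_ratio_bound:
  assumes p: "0 \<le> p" "p \<le> 1 / 2" and B: "\<And>j. \<bar>f j\<bar> \<le> B" and l: "l \<ge> 0" and \<eta>: "0 < \<eta>" "\<eta> \<le> 1 / 2"
    and R: "overlap_defect E a (percolation E p) (\<lambda>e. X e w) \<le> \<eta> * (\<Prod>e\<in>E. 1 - p + p * X e w)\<^sup>2"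
    and W: "poisson_defect p l w \<le> \<eta>"
  shows "above E a (\<lambda>e. X e w) {} \<noteq> 0"
    and "\<bar>overlap_form E a (\<lambda>e. X e w) f / (above E a (\<lambda>e. X e w) {})\<^sup>2 - poisson_mean f l\<bar> \<le> 8 * B * \<eta>"
proof -
  let ?x = "\<lambda>e. X e w" and ?b = "percolation E p"
  let ?N = "\<Prod>e\<in>E. 1 - p + p * X e w" and ?y = "\<lambda>e. (p * X e w / (1 - p + p * X e w))\<^sup>2"
  let ?R = "overlap_defect E a ?b ?x" and ?h = "\<Sum>\<Gamma>\<in>Pow E. newton f (card \<Gamma>) * prod ?y \<Gamma>"
  let ?A = "overlap_form E a ?x f" and ?Z = "(above E a ?x {})\<^sup>2" and ?\<phi> = "poisson_mean f l"
  have B0: "B \<ge> 0" using B[of 0] by linarith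
  have d: "1 - p + p * X e w > 0" if "e \<in> E" for e
    using p mult_nonneg_nonneg[OF p(1) X_nonneg[OF that, of w]] by linarith
  then have N: "?N > 0" by (intro prod_pos) auto
  have dn: "1 - p + p * X e w \<noteq> 0" if "e \<in> E" for e using d[OF that] by simp
  have A: "\<bar>?A - ?N\<^sup>2 * ?h\<bar> \<le> B * ?R"
    using overlap_form_diff_le[of E f B, OF finite_E B, of a ?x ?b] overlap_form_percolation[OF finite_E, of p ?x f] dn
    by simp
  have "above E ?b ?x {} = ?N"
    by (simp add: above_percolation finite_E)
  \<comment> \<open>The denominator is the overlap form of the constant function 1, so the same
    comparison applies.\<close>
  then have Z: "\<bar>?Z - ?N\<^sup>2\<bar> \<le> ?R"
    using overlap_form_diff_le[of E "\<lambda>_. 1" 1 a ?x ?b] by (simp add: overlap_form_1 finite_E)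
  have y: "0 \<le> ?y e \<and> ?y e \<le> 1" if "e \<in> E" for e
    using tilted_square_approx(3)[OF p X_nonneg[OF that, of w]] by simp
  have "\<bar>?h - poisson_mean f (sum ?y E)\<bar> \<le> 2 * B * (\<Sum>e\<in>E. (?y e)\<^sup>2)"
    using le_cam[of E ?y f B] finite_E y B by blast
  moreover have "\<bar>poisson_mean f (sum ?y E) - ?\<phi>\<bar> \<le> 2 * B * \<bar>sum ?y E - l\<bar>"
    using l by (intro poisson_mean_lipschitz[of f B, OF B] sum_nonneg) auto
  ultimately have "\<bar>?h - ?\<phi>\<bar> \<le> 2 * B * poisson_defect p l w"
    unfolding poisson_defect_def by (simp add: algebra_simps)
  also have "\<dots> \<le> 2 * B * \<eta>" using W B0 by (intro mult_left_mono) auto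
  finally have h: "\<bar>?h - ?\<phi>\<bar> \<le> 2 * B * \<eta>" .
  have "?R \<le> ?N\<^sup>2 / 2" using R \<eta> mult_right_mono[OF \<eta>(2), of "?N\<^sup>2"] by simp
  then have Z2: "?Z \<ge> ?N\<^sup>2 / 2" using Z by linarith
  moreover have "?N\<^sup>2 > 0" using N by simp
  ultimately have Zpos: "?Z > 0" by linarith
  then show "above E a ?x {} \<noteq> 0" by auto
  have \<phi>: "\<bar>?\<phi>\<bar> \<le> B" by (rule abs_poisson_mean_le[of f B, OF B l])
  have "?A - ?\<phi> * ?Z = (?A - ?N\<^sup>2 * ?h) + ?N\<^sup>2 * (?h - ?\<phi>) - ?\<phi> * (?Z - ?N\<^sup>2)"
    by (simp add: algebra_simps)
  moreover have "\<bar>?N\<^sup>2 * (?h - ?\<phi>)\<bar> \<le> ?N\<^sup>2 * (2 * B * \<eta>)"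
    unfolding abs_mult using h by (intro mult_mono) auto
  moreover have "\<bar>?\<phi> * (?Z - ?N\<^sup>2)\<bar> \<le> B * ?R"
    unfolding abs_mult using Z \<phi> B0 by (intro mult_mono) auto
  moreover have "B * ?R \<le> B * (\<eta> * ?N\<^sup>2)" using R B0 by (intro mult_left_mono)
  ultimately have "\<bar>?A - ?\<phi> * ?Z\<bar> \<le> 4 * B * \<eta> * ?N\<^sup>2" using A by (simp add: algebra_simps)
  also have "\<dots> = 8 * B * \<eta> * (?N\<^sup>2 / 2)" by simp
  also have "\<dots> \<le> 8 * B * \<eta> * ?Z" using Z2 B0 \<eta> by (intro mult_left_mono) auto
  finally have "\<bar>?A - ?\<phi> * ?Z\<bar> / ?Z \<le> 8 * B * \<eta>" using Zpos by (simp add: divide_le_eq)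
  moreover have "?A / ?Z - ?\<phi> = (?A - ?\<phi> * ?Z) / ?Z" using Zpos by (simp add: field_simps)
  ultimately show "\<bar>?A / ?Z - ?\<phi>\<bar> \<le> 8 * B * \<eta>" using Zpos by (simp add: abs_divide)
qed

text \<open>Markov's inequality for three bad events. The threshold \<delta> separates the event of
  a small percolation partition function, so that an absolute bound on the overlap defect becomes
  the relative one required above.\<close>

lemma (in iid_factors) prob_overlap_ratio_le:
  assumes p: "0 \<le> p" "p \<le> 1 / 2" and B: "\<And>j. \<bar>f j\<bar> \<le> B" and l: "l \<ge> 0" and \<eta>: "0 < \<eta>" "\<eta> \<le> 1 / 2"
    and \<delta>: "\<delta> > 0" and E: "E \<noteq> {}"
    and G [measurable]: "G \<in> borel_measurable M"
    and eq: "AE w in M. above E a (\<lambda>e. X e w) {} \<noteq> 0 \<longrightarrow>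
      G w = overlap_form E a (\<lambda>e. X e w) f / (above E a (\<lambda>e. X e w) {})\<^sup>2"
  shows "prob {w \<in> space M. \<bar>G w - poisson_mean f l\<bar> > 8 * B * \<eta>} \<le>
    expectation (\<lambda>w. overlap_defect E a (percolation E p) (\<lambda>e. X e w)) / (\<eta> * \<delta>\<^sup>2)
    + \<delta> * expectation (\<lambda>w. 1 / (\<Prod>e\<in>E. 1 - p + p * X e w))
    + expectation (poisson_defect p l) / \<eta>"
proof -
  let ?R = "\<lambda>w. overlap_defect E a (percolation E p) (\<lambda>e. X e w)"
  let ?I = "\<lambda>w. 1 / (\<Prod>e\<in>E. 1 - p + p * X e w)"
  let ?W = "poisson_defect p l"
  have intR: "integrable M ?R" by (rule integrable_overlap_defect)
  have intI: "integrable M ?I" by (rule integrable_inverse_prod[OF p])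
  have intW: "integrable M ?W" by (rule integrable_poisson_defect[OF p E])
  note [measurable] = borel_measurable_integrable[OF intR] borel_measurable_integrable[OF intI]
    borel_measurable_integrable[OF intW]
  have N: "(\<Prod>e\<in>E. 1 - p + p * X e w) > 0" for w
  proof (rule prod_pos)
    fix e assume "e \<in> E"
    then show "0 < 1 - p + p * X e w"
      using p mult_nonneg_nonneg[OF p(1) X_nonneg, of e w] by linarith
  qed
  let ?A1 = "{w \<in> space M. ?R w \<ge> \<eta> * \<delta>\<^sup>2}" and ?A2 = "{w \<in> space M. ?I w \<ge> 1 / \<delta>}"
    and ?A3 = "{w \<in> space M. ?W w \<ge> \<eta>}"
  have "prob {w \<in> space M. \<bar>G w - poisson_mean f l\<bar> > 8 * B * \<eta>} \<le> prob (?A1 \<union> ?A2 \<union> ?A3)"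
  proof (rule finite_measure_mono_AE)
    show "AE w in M. w \<in> {w \<in> space M. \<bar>G w - poisson_mean f l\<bar> > 8 * B * \<eta>} \<longrightarrow> w \<in> ?A1 \<union> ?A2 \<union> ?A3"
      using eq
    proof eventually_elim
      case (elim w)
      show ?case
      proof (rule impI, rule ccontr)
        assume w: "w \<in> {w \<in> space M. \<bar>G w - poisson_mean f l\<bar> > 8 * B * \<eta>}" "w \<notin> ?A1 \<union> ?A2 \<union> ?A3"
        then have 1: "?R w < \<eta> * \<delta>\<^sup>2" and 2: "?I w < 1 / \<delta>" and 3: "?W w \<le> \<eta>" by auto
        from 2 have "\<delta> < (\<Prod>e\<in>E. 1 - p + p * X e w)" using N[of w] \<delta> by (simp add: field_simps)
        then have "\<delta>\<^sup>2 \<le> (\<Prod>e\<in>E. 1 - p + p * X e w)\<^sup>2" using \<delta> by (intro power_mono) auto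
        then have "\<eta> * \<delta>\<^sup>2 \<le> \<eta> * (\<Prod>e\<in>E. 1 - p + p * X e w)\<^sup>2" using \<eta> by (intro mult_left_mono) auto
        with 1 have R: "?R w \<le> \<eta> * (\<Prod>e\<in>E. 1 - p + p * X e w)\<^sup>2" by linarith
        from overlap_ratio_bound[where f = f, OF p B l \<eta> R 3] elim w show False by auto
      qed
    qed
  qed measurable
  also have "\<dots> \<le> prob ?A1 + prob ?A2 + prob ?A3"
    by (intro order.trans[OF measure_Un_le] add_mono measure_Un_le order_refl) auto
  also have "prob ?A1 \<le> expectation ?R / (\<eta> * \<delta>\<^sup>2)"
    using \<eta> \<delta> by (intro integral_Markov_inequality_measure[OF intR, of "space M"]) (auto simp: overlap_defect_nonneg)
  also have "prob ?A2 \<le> expectation ?I / (1 / \<delta>)"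
    using \<delta> N by (intro integral_Markov_inequality_measure[OF intI, of "space M"]) (auto simp: less_imp_le)
  also have "prob ?A3 \<le> expectation ?W / \<eta>"
    using \<eta> by (intro integral_Markov_inequality_measure[OF intW, of "space M"]) (auto simp: poisson_defect_nonneg)
  finally show ?thesis by (simp add: mult.commute)
qed

section \<open>Asymptotics\<close>

text \<open>The limit superior of \<open>r\<close> is at most \<open>k * C\<close> for every
  \<open>k > 0\<close>. This serves both the free parameter of the mean inequality and the threshold
  \<delta>.\<close>

lemma tendsto_0_of_family:
  fixes r :: "nat \<Rightarrow> real"
  assumes nonneg: "\<forall>\<^sub>F n in sequentially. 0 \<le> r n"
    and le: "\<And>k. k > 0 \<Longrightarrow> \<forall>\<^sub>F n in sequentially. r n \<le> g k n"
    and lim: "\<And>k. k > 0 \<Longrightarrow> g k \<longlonglongrightarrow> k * C"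
  shows "r \<longlonglongrightarrow> 0"
proof (rule tendstoI)
  fix e :: real assume e: "e > 0"
  define k where "k = e / (\<bar>C\<bar> + 1)"
  have k: "k > 0" using e by (simp add: k_def)
  have "k * C \<le> k * \<bar>C\<bar>" using k by (intro mult_left_mono) auto
  also have "\<dots> < k * (\<bar>C\<bar> + 1)" using k by (intro mult_strict_left_mono) auto
  also have "\<dots> = e" by (simp add: k_def)
  finally have "\<forall>\<^sub>F n in sequentially. g k n < e" by (intro order_tendstoD[OF lim[OF k]])
  with nonneg le[OF k] show "\<forall>\<^sub>F n in sequentially. dist (r n) 0 < e"
    by eventually_elim auto
qed

lemma power_one_plus_ge:
  fixes a :: real
  assumes "0 \<le> a" "a \<le> 1"
  shows "(1 + a) ^ k \<ge> exp (real k * (a - a\<^sup>2))"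
proof -
  have "real k * (a - a\<^sup>2) \<le> real k * ln (1 + a)"
    using ln_one_plus_pos_lower_bound[OF assms] by (intro mult_left_mono) auto
  then have "exp (real k * (a - a\<^sup>2)) \<le> exp (ln (1 + a)) ^ k"
    by (simp add: exp_of_nat_mult[symmetric])
  then show ?thesis using assms by simp
qed

lemma power_one_plus_le:
  fixes a :: real
  assumes "a \<ge> 0"
  shows "(1 + a) ^ k \<le> exp (real k * a)"
  using power_mono[OF exp_ge_add_one_self[of a], of k] assms by (simp add: exp_of_nat_mult)

section \<open>Limits of the graph parameters and of the pairings\<close>

context optimization_problem
begin

abbreviation "num_edges n \<equiv> real (card (E n))"
abbreviation "edge_density n \<equiv> real (m n) / num_edges n"
text \<open>The expected number of common edges of two independent percolation samples, equal to
  \<open>m^2 / card E\<close>.\<close>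

abbreviation "mean_overlap n \<equiv> (edge_density n)\<^sup>2 * num_edges n"

lemma finite_edges: "n \<ge> 1 \<Longrightarrow> finite (E n)"
  using graph[of n] finite_subset[of "E n" "Pow (V n)"] by (auto simp: finite_graph_def)

lemma mean_overlap_limit: "mean_overlap \<longlonglongrightarrow> 2 * \<gamma>"
proof -
  have "(\<lambda>n. 2 * (real (m n) ^ 2 / (2 * num_edges n))) \<longlonglongrightarrow> 2 * \<gamma>"
    by (intro tendsto_intros gamma_lim)
  moreover have "2 * (real (m n) ^ 2 / (2 * num_edges n)) = mean_overlap n" for n
    by (cases "num_edges n = 0") (simp_all add: power2_eq_square)
  ultimately show ?thesis by simp
qed

lemma eventually_pos: "\<forall>\<^sub>F n in sequentially. n \<ge> 1 \<and> num_edges n > 0 \<and> real (m n) > 0"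
proof -
  have "\<forall>\<^sub>F n in sequentially. mean_overlap n > 0"
    using order_tendstoD(1)[OF mean_overlap_limit, of 0] gamma_pos by simp
  with eventually_ge_at_top[of 1] show ?thesis
    by eventually_elim (auto simp: zero_less_mult_iff zero_less_power2)
qed

lemma card_vertices_at_top: "filterlim (\<lambda>n. real (card (V n))) at_top sequentially"
proof -
  obtain c :: nat where c: "\<And>n. n \<ge> 1 \<Longrightarrow> card (V n) = c * n" using card_vertices by blast
  \<comment> \<open>The assumption on vertex counts admits \<open>c = 0\<close>; this is excluded
    because \<gamma> > 0 forces edges to exist.\<close>
  have "c \<noteq> 0"
  proof
    assume "c = 0"
    from eventually_happens[OF eventually_pos] obtain n where n: "n \<ge> 1" "num_edges n > 0" by auto
    with c[OF n(1)] \<open>c = 0\<close> graph[OF n(1)] have "V n = {}" "E n \<subseteq> {e. e \<subseteq> V n \<and> card e = 2}"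
      by (auto simp: finite_graph_def)
    then have "E n = {}" by auto
    with n show False by simp
  qed
  then have "filterlim (\<lambda>n. real c * real n) at_top sequentially"
    by (intro filterlim_tendsto_pos_mult_at_top[OF tendsto_const] filterlim_real_sequentially) auto
  moreover have "\<forall>\<^sub>F n in sequentially. real c * real n = real (card (V n))"
    using eventually_ge_at_top[of 1] by eventually_elim (simp add: c)
  ultimately show ?thesis by (rule filterlim_mono_eventually[OF _ order_refl order_refl])
qed

text \<open>The lower half of the quadratic edge count bounds the ratio by a multiple of
  \<open>1 / card (V n)\<close>.\<close>

lemma vertices_edges_ratio: "(\<lambda>n. real (card (V n)) / num_edges n) \<longlonglongrightarrow> 0"
proof -
  from card_edges have "(\<lambda>n. num_edges n) \<in> \<Omega>(\<lambda>n. real (card (V n)) ^ 2)" by (simp add: bigtheta_def)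
  then obtain c where c: "c > 0" and le: "\<forall>\<^sub>F n in sequentially. c * real (card (V n)) ^ 2 \<le> num_edges n"
    by (auto elim!: landau_omega.bigE)
  have lim: "(\<lambda>n. 1 / c * (1 / real (card (V n)))) \<longlonglongrightarrow> 1 / c * 0"
    by (intro tendsto_intros tendsto_divide_0[OF tendsto_const] filterlim_at_top_imp_at_infinity card_vertices_at_top)
  have le': "\<forall>\<^sub>F n in sequentially. real (card (V n)) / num_edges n \<le> 1 / c * (1 / real (card (V n)))"
    using le eventually_pos filterlim_at_top_dense[THEN iffD1, OF card_vertices_at_top, rule_format, of 0]
  proof eventually_elim
    case (elim n)
    then show ?case using c by (simp add: field_simps power2_eq_square)
  qed
  have "\<forall>\<^sub>F n in sequentially. 0 \<le> real (card (V n)) / num_edges n" by simp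
  from tendsto_sandwich[OF this le' tendsto_const] lim show ?thesis by simp
qed

lemma card_edges_at_top: "filterlim num_edges at_top sequentially"
proof -
  have "\<forall>\<^sub>F n in sequentially. real (card (V n)) / num_edges n < 1"
    using order_tendstoD(2)[OF vertices_edges_ratio, of 1] by simp
  then have "\<forall>\<^sub>F n in sequentially. real (card (V n)) \<le> num_edges n"
    using eventually_pos by eventually_elim (simp add: divide_less_eq)
  then show ?thesis by (rule filterlim_at_top_mono[OF card_vertices_at_top])
qed

lemma edge_density_limit: "edge_density \<longlonglongrightarrow> 0"
proof -
  have "(\<lambda>n. mean_overlap n / num_edges n) \<longlonglongrightarrow> 0"
    by (intro tendsto_divide_0[OF mean_overlap_limit] filterlim_at_top_imp_at_infinity card_edges_at_top)
  moreover have "\<forall>\<^sub>F n in sequentially. mean_overlap n / num_edges n = (edge_density n)\<^sup>2"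
    using eventually_pos by eventually_elim simp
  ultimately have "(\<lambda>n. (edge_density n)\<^sup>2) \<longlonglongrightarrow> 0" by (rule Lim_transform_eventually)
  from tendsto_real_sqrt[OF this] show ?thesis by simp
qed

lemma inverse_sqrt_m_limit: "(\<lambda>n. 1 / sqrt (real (m n))) \<longlonglongrightarrow> 0"
proof -
  have "(\<lambda>n. edge_density n / mean_overlap n) \<longlonglongrightarrow> 0 / (2 * \<gamma>)"
    using gamma_pos by (intro tendsto_divide edge_density_limit mean_overlap_limit) simp
  \<comment> \<open>Since \<open>p * card E = m\<close>, the quotient
    \<open>p / (p^2 * card E)\<close> is \<open>1 / m\<close>.\<close>
  moreover have "\<forall>\<^sub>F n in sequentially. edge_density n / mean_overlap n = 1 / real (m n)"
    using eventually_pos by eventually_elim (simp add: power2_eq_square field_simps)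
  ultimately have "(\<lambda>n. 1 / real (m n)) \<longlonglongrightarrow> 0" by (auto intro: Lim_transform_eventually)
  from tendsto_real_sqrt[OF this] show ?thesis by (simp add: real_sqrt_divide)
qed

abbreviation "uniform_pairing u n \<equiv> overlap_pairing (E n) (uniform (S n)) (uniform (S n)) u"
abbreviation "mixed_pairing u n \<equiv>
  overlap_pairing (E n) (uniform (S n)) (percolation (E n) (edge_density n)) u"
abbreviation "percolation_pairing u n \<equiv>
  overlap_pairing (E n) (percolation (E n) (edge_density n)) (percolation (E n) (edge_density n)) u"

text \<open>A convergent majorant is enough, because the uniform pairing is only needed with a
  positive sign.\<close>

lemma uniform_pairing_bound:
  assumes u: "u \<ge> 1"
  shows "\<exists>U. U \<longlonglongrightarrow> exp ((u - 1) * (2 * \<gamma>)) \<and> (\<forall>\<^sub>F n in sequentially. uniform_pairing u n \<le> U n)"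
proof -
  obtain r where r: "r > 0" and matching: "\<And>n \<Gamma>. n \<ge> 1 \<Longrightarrow> partial_matching (E n) \<Gamma> \<Longrightarrow>
      \<bar>prob_contains (S n) \<Gamma> / (\<Prod>e\<in>\<Gamma>. prob_contains (S n) {e}) - 1\<bar> \<le> r ^ card \<Gamma> / sqrt (real (m n))"
    using matching_quasi_independent by blast
  obtain r' where r': "r' > 0" and nm: "\<forall>n\<ge>1. \<forall>\<Gamma>. (\<exists>\<pi>\<in>S n. \<Gamma> \<subseteq> \<pi>) \<and> \<not> partial_matching (E n) \<Gamma> \<longrightarrow>
      prob_contains (S n) \<Gamma> \<le> r' ^ card \<Gamma> * (\<Prod>e\<in>\<Gamma>. prob_contains (S n) {e})"
    using nonmatching_bound by (elim exE conjE)
  have nonmatching: "prob_contains (S n) \<Gamma> \<le> r' ^ card \<Gamma> * (\<Prod>e\<in>\<Gamma>. prob_contains (S n) {e})"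
    if "n \<ge> 1" "\<exists>\<pi>\<in>S n. \<Gamma> \<subseteq> \<pi>" "\<not> partial_matching (E n) \<Gamma>" for n \<Gamma>
    by (rule nm[rule_format, OF that(1) conjI[OF that(2,3)]])
  let ?d = "\<lambda>n. 1 / sqrt (real (m n))"
  let ?U = "\<lambda>n. exp ((u - 1) * mean_overlap n) + 2 * ?d n * exp ((u - 1) * r * mean_overlap n)
    + (?d n)\<^sup>2 * exp ((u - 1) * r\<^sup>2 * mean_overlap n)
    + 2 * ((u - 1) * r'\<^sup>2)\<^sup>2 * (real (card (V n)) / num_edges n) * (mean_overlap n)\<^sup>2
      * exp ((u - 1) * r'\<^sup>2 * mean_overlap n)"
  have "?U \<longlonglongrightarrow> exp ((u - 1) * (2 * \<gamma>)) + 2 * 0 * exp ((u - 1) * r * (2 * \<gamma>))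
    + 0\<^sup>2 * exp ((u - 1) * r\<^sup>2 * (2 * \<gamma>))
    + 2 * ((u - 1) * r'\<^sup>2)\<^sup>2 * 0 * (2 * \<gamma>)\<^sup>2 * exp ((u - 1) * r'\<^sup>2 * (2 * \<gamma>))"
    by (intro tendsto_add tendsto_mult tendsto_exp tendsto_power tendsto_const
      mean_overlap_limit inverse_sqrt_m_limit vertices_edges_ratio)
  moreover have "\<forall>\<^sub>F n in sequentially. uniform_pairing u n \<le> ?U n"
    using eventually_pos
  proof eventually_elim
    case (elim n)
    then have n: "n \<ge> 1" and pos: "edge_density n > 0" by auto
    show ?case
      by (rule overlap_pairing_uniform_le[OF graph[OF n] _ nonempty[OF n] u pos edge_prob[OF n] _ _
            nonmatching[OF n] r r'])
         (use subgraphs[OF n] matching[OF n] in auto)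
  qed
  ultimately show ?thesis by (intro exI[of _ ?U]) simp
qed

text \<open>The mixed pairing enters negatively, so it is bounded from below and the other two from
  above. All three bounds have the same limit, which cancels in the mean square difference.\<close>

lemma pairing_limits:
  assumes u: "u \<ge> 1"
  shows "\<exists>d A. d \<longlonglongrightarrow> 0 \<and> A \<longlonglongrightarrow> 2 * exp ((u - 1) * (2 * \<gamma>)) \<and>
    (\<forall>\<^sub>F n in sequentially. uniform_pairing u n - 2 * mixed_pairing u n + percolation_pairing u n \<le> d n) \<and>
    (\<forall>\<^sub>F n in sequentially. uniform_pairing u n + percolation_pairing u n \<le> A n)"
proof -
  obtain U where U: "U \<longlonglongrightarrow> exp ((u - 1) * (2 * \<gamma>))" "\<forall>\<^sub>F n in sequentially. uniform_pairing u n \<le> U n"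
    using uniform_pairing_bound[OF u] by blast
  let ?m = "\<lambda>n. exp ((u - 1) * mean_overlap n - (u - 1)\<^sup>2 * edge_density n * mean_overlap n)"
  let ?p = "\<lambda>n. exp ((u - 1) * mean_overlap n)"
  have "(\<lambda>n. U n - 2 * ?m n + ?p n) \<longlonglongrightarrow> exp ((u - 1) * (2 * \<gamma>))
      - 2 * exp ((u - 1) * (2 * \<gamma>) - (u - 1)\<^sup>2 * 0 * (2 * \<gamma>)) + exp ((u - 1) * (2 * \<gamma>))"
    by (intro tendsto_add tendsto_diff tendsto_mult tendsto_exp tendsto_const U(1)
      mean_overlap_limit edge_density_limit)
  then have d: "(\<lambda>n. U n - 2 * ?m n + ?p n) \<longlonglongrightarrow> 0" by simp
  have "(\<lambda>n. U n + ?p n) \<longlonglongrightarrow> exp ((u - 1) * (2 * \<gamma>)) + exp ((u - 1) * (2 * \<gamma>))"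
    by (intro tendsto_add tendsto_mult tendsto_exp tendsto_const U(1) mean_overlap_limit)
  then have A: "(\<lambda>n. U n + ?p n) \<longlonglongrightarrow> 2 * exp ((u - 1) * (2 * \<gamma>))" by simp
  have perc: "\<forall>\<^sub>F n in sequentially. percolation_pairing u n \<le> ?p n"
    using eventually_pos
  proof eventually_elim
    case (elim n)
    then have "percolation_pairing u n = (1 + (edge_density n)\<^sup>2 * (u - 1)) ^ card (E n)"
      by (intro overlap_pairing_percolation finite_edges) simp
    also have "\<dots> \<le> exp (num_edges n * ((edge_density n)\<^sup>2 * (u - 1)))"
      using u by (intro power_one_plus_le) simp
    finally show ?case by (simp add: mult_ac)
  qed
  have "(\<lambda>n. edge_density n * (u - 1)) \<longlonglongrightarrow> 0 * (u - 1)"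
    by (intro tendsto_intros edge_density_limit)
  then have small: "\<forall>\<^sub>F n in sequentially. edge_density n * (u - 1) < 1"
    by (intro order_tendstoD(2)) auto
  \<comment> \<open>To be read with \<open>k = m\<close>, \<open>r = card E\<close> and
    \<open>v = u - 1\<close>, so that \<open>k / r\<close> is the edge density.\<close>
  have alg: "k * (k / r * v - (k / r * v)\<^sup>2) = v * ((k / r)\<^sup>2 * r) - v\<^sup>2 * (k / r) * ((k / r)\<^sup>2 * r)"
    if "r \<noteq> 0" for k r v :: real
    using that by (simp add: field_simps power2_eq_square)
  have mixed: "\<forall>\<^sub>F n in sequentially. mixed_pairing u n \<ge> ?m n"
    using eventually_pos small
  proof eventually_elim
    case (elim n)
    then have "mixed_pairing u n = (1 + edge_density n * (u - 1)) ^ m n"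
      using subgraphs[of n] card_subgraph[of n] nonempty[of n]
      by (intro overlap_pairing_uniform_percolation finite_edges) auto
    moreover have "(1 + edge_density n * (u - 1)) ^ m n
        \<ge> exp (real (m n) * (edge_density n * (u - 1) - (edge_density n * (u - 1))\<^sup>2))"
      using elim u by (intro power_one_plus_ge) auto
    moreover have "real (m n) * (edge_density n * (u - 1) - (edge_density n * (u - 1))\<^sup>2) =
        (u - 1) * mean_overlap n - (u - 1)\<^sup>2 * edge_density n * mean_overlap n"
      using elim by (intro alg) auto
    ultimately show ?case by simp
  qed
  have "\<forall>\<^sub>F n in sequentially. uniform_pairing u n - 2 * mixed_pairing u n + percolation_pairing u n
      \<le> U n - 2 * ?m n + ?p n"
    using U(2) perc mixed by eventually_elim linarith
  moreover have "\<forall>\<^sub>F n in sequentially. uniform_pairing u n + percolation_pairing u n \<le> U n + ?p n"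
    using U(2) perc by eventually_elim linarith
  ultimately show ?thesis using d A by blast
qed

end

section \<open>Weak convergence of the overlap law in probability\<close>

theorem theorem2p4:
  fixes V :: "nat \<Rightarrow> 'v set" and E :: "nat \<Rightarrow> 'v set set" and S :: "nat \<Rightarrow> 'v set set set"
    and m :: "nat \<Rightarrow> nat" and \<gamma> \<beta> :: real
    and \<mu> :: "ereal measure" and M :: "nat \<Rightarrow> 'w measure"
    and \<omega> :: "nat \<Rightarrow> 'v set \<Rightarrow> 'w \<Rightarrow> ereal"
  assumes "optimization_problem V E S m \<gamma>"
    and "iid_weights E \<mu> M \<omega>"
    and "\<beta> \<ge> 0"
  shows "weak_conv_in_prob M (\<lambda>n x. overlap_law (S n) \<beta> (\<lambda>e. \<omega> n e x))
    (poisson_pmf (2 * \<gamma> * exp (log_laplace \<mu> (2 * \<beta>) - 2 * log_laplace \<mu> \<beta>)))"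
proof -
  interpret P: optimization_problem V E S m \<gamma> by fact
  interpret W: iid_weights E \<mu> M \<omega> by fact
  interpret \<mu>: prob_space \<mu> by (rule W.law)
  have b_meas [measurable]: "boltzmann b \<in> borel_measurable \<mu>" for b
    using boltzmann_measurable W.law(2) by (simp cong: measurable_cong_sets)
  define L where "L b = (\<integral>x. boltzmann b x \<partial>\<mu>)" for b
  have L: "L b > 0" if "b \<ge> 0" for b
  proof -
    have "L b \<ge> 0" unfolding L_def by (intro Bochner_Integration.integral_nonneg boltzmann_nonneg)
    \<comment> \<open>The Boltzmann factor vanishes only at infinite weight, which is not almost
      sure.\<close>
    moreover have "L b \<noteq> 0"
    proof
      assume "L b = 0"
      then have "AE x in \<mu>. boltzmann b x = 0"
        unfolding L_def using W.laplace_finite[OF that]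
        by (subst (asm) integral_nonneg_eq_0_iff_AE) (auto simp: boltzmann_nonneg)
      then have "AE x in \<mu>. x = \<infinity>" by eventually_elim (auto simp: boltzmann_def split: if_splits)
      with W.not_as_infinity show False by simp
    qed
    ultimately show ?thesis by simp
  qed
  \<comment> \<open>Second and fourth moments of the normalised weights; \<open>s\<close> is also
    the exponential in the Poisson rate.\<close>
  define s where "s = L (2 * \<beta>) / (L \<beta>)\<^sup>2"
  define c where "c = L (4 * \<beta>) / L \<beta> ^ 4"
  define l where "l = 2 * \<gamma> * s"
  define X where "X n e x = boltzmann \<beta> (\<omega> n e x) / L \<beta>" for n e x
  have s_pos: "s > 0" using L[of \<beta>] L[of "2 * \<beta>"] assms(3) by (simp add: s_def)
  have "exp (log_laplace \<mu> (2 * \<beta>) - 2 * log_laplace \<mu> \<beta>) = s"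
    using L[of \<beta>] L[of "2 * \<beta>"] assms(3)
    by (simp add: log_laplace_def L_def[symmetric] s_def exp_diff exp_of_nat_mult[of 2, simplified])
  then have rate: "2 * \<gamma> * exp (log_laplace \<mu> (2 * \<beta>) - 2 * log_laplace \<mu> \<beta>) = l"
    by (simp add: l_def)
  have l: "l > 0" using s_pos P.gamma_pos by (simp add: l_def)

  have \<omega>_meas: "\<omega> n e \<in> borel_measurable (M n)" if "n \<ge> 1" "e \<in> E n" for n e
    using W.indep[OF that(1)] that(2) unfolding prob_space.indep_vars_def2[OF W.prob[OF that(1)]] by auto
  have moment: "integrable (M n) (\<lambda>x. X n e x ^ k)"
    "(\<integral>x. X n e x ^ k \<partial>M n) = L (real k * \<beta>) / L \<beta> ^ k"
    if n: "n \<ge> 1" and e: "e \<in> E n" and k: "k > 0" for n e k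
  proof -
    have eq: "X n e x ^ k = boltzmann (real k * \<beta>) (\<omega> n e x) / L \<beta> ^ k" for x
      using k by (simp add: X_def power_divide boltzmann_power)
    have d: "distr (M n) borel (\<omega> n e) = \<mu>" by (rule W.ident[OF n e])
    have int: "integrable (distr (M n) borel (\<omega> n e)) (boltzmann (real k * \<beta>))"
      unfolding d using assms(3) by (intro W.laplace_finite) simp
    then show "integrable (M n) (\<lambda>x. X n e x ^ k)"
      unfolding eq using \<omega>_meas[OF n e] by (intro integrable_divide) (simp add: integrable_distr_eq)
    show "(\<integral>x. X n e x ^ k \<partial>M n) = L (real k * \<beta>) / L \<beta> ^ k"
      unfolding eq L_def d[symmetric] using \<omega>_meas[OF n e] by (simp add: integral_distr)
  qed
  have iid: "iid_factors (M n) (E n) (X n) s c" if n: "n \<ge> 1" for n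
  proof -
    interpret prob_space "M n" by (rule W.prob[OF n])
    show ?thesis
    proof
      show "finite (E n)" by (rule P.finite_edges[OF n])
      show "indep_vars (\<lambda>_. borel) (X n) (E n)"
        unfolding X_def[abs_def] by (rule indep_vars_compose2[OF W.indep[OF n]]) measurable
      fix e
      show "X n e x \<ge> 0" for x
        using L[OF assms(3)] by (simp add: X_def boltzmann_nonneg)
      assume e: "e \<in> E n"
      show "integrable (M n) (\<lambda>x. X n e x ^ k)" for k
        using moment(1)[OF n e, of k] by (cases "k = 0") auto
      show "expectation (X n e) = 1"
        using moment(2)[OF n e, of 1] L[OF assms(3)] by simp
      show "expectation (\<lambda>x. (X n e x)\<^sup>2) = s"
        using moment(2)[OF n e, of 2] by (simp add: s_def)
      show "expectation (\<lambda>x. X n e x ^ 4) \<le> c"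
        using moment(2)[OF n e, of 4] by (simp add: c_def)
    qed
  qed

  have s1: "s \<ge> 1"
  proof -
    from eventually_happens[OF P.eventually_pos] obtain n where "n \<ge> 1" "P.num_edges n > 0" by auto
    moreover from this have "E n \<noteq> {}" by auto
    ultimately show ?thesis using iid_factors.second_moment_ge_1[OF iid] by blast
  qed

  let ?p = P.edge_density and ?P = P.mean_overlap and ?q = P.num_edges
  define R where "R n = (\<integral>x. overlap_defect (E n) (uniform (S n)) (percolation (E n) (?p n)) (\<lambda>e. X n e x) \<partial>M n)" for n
  define D where "D n = (\<integral>x. iid_factors.poisson_defect (E n) (X n) (?p n) l x \<partial>M n)" for n
  define I where "I n = (\<integral>x. 1 / (\<Prod>e\<in>E n. 1 - ?p n + ?p n * X n e x) \<partial>M n)" for n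

  have "\<forall>\<^sub>F n in sequentially. ?p n < 1 / 2"
    using order_tendstoD(2)[OF P.edge_density_limit, of "1 / 2"] by simp
  with P.eventually_pos
  have good: "\<forall>\<^sub>F n in sequentially. n \<ge> 1 \<and> E n \<noteq> {} \<and> 0 \<le> ?p n \<and> ?p n \<le> 1 / 2"
    by eventually_elim auto

  have R: "R \<longlonglongrightarrow> 0"
  proof -
    \<comment> \<open>The base 3 comes from the overlap defect, the factor \<open>s\<close> from
      averaging over the weights.\<close>
    let ?u = "3 * s"
    obtain d A where d: "d \<longlonglongrightarrow> 0" and A: "A \<longlonglongrightarrow> 2 * exp ((?u - 1) * (2 * \<gamma>))"
      and dle: "\<forall>\<^sub>F n in sequentially.
        P.uniform_pairing ?u n - 2 * P.mixed_pairing ?u n + P.percolation_pairing ?u n \<le> d n"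
      and Ale: "\<forall>\<^sub>F n in sequentially. P.uniform_pairing ?u n + P.percolation_pairing ?u n \<le> A n"
      using P.pairing_limits[of ?u] s1 by auto
    show ?thesis
    proof (rule tendsto_0_of_family)
      show "\<forall>\<^sub>F n in sequentially. 0 \<le> R n"
        using good
      proof eventually_elim
        case (elim n)
        then show ?case unfolding R_def
          by (intro Bochner_Integration.integral_nonneg iid_factors.overlap_defect_nonneg[OF iid]) auto
      qed
      fix k :: real assume k: "k > 0"
      show "\<forall>\<^sub>F n in sequentially. R n \<le> d n / (2 * k) + k * A n"
        using good dle Ale
      proof eventually_elim
        case (elim n)
        then have "R n \<le> (P.uniform_pairing ?u n - 2 * P.mixed_pairing ?u n + P.percolation_pairing ?u n) / (2 * k)
            + k * (P.uniform_pairing ?u n + P.percolation_pairing ?u n)"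
          unfolding R_def by (intro iid_factors.expectation_overlap_defect_le[OF iid] k) auto
        also have "\<dots> \<le> d n / (2 * k) + k * A n"
          using elim k by (intro add_mono divide_right_mono mult_left_mono) auto
        finally show ?case .
      qed
      have "(\<lambda>n. d n / (2 * k) + k * A n) \<longlonglongrightarrow> 0 / (2 * k) + k * (2 * exp ((?u - 1) * (2 * \<gamma>)))"
        using k by (intro tendsto_intros d A) auto
      then show "(\<lambda>n. d n / (2 * k) + k * A n) \<longlonglongrightarrow> k * (2 * exp ((?u - 1) * (2 * \<gamma>)))" by simp
    qed
  qed

  have D: "D \<longlonglongrightarrow> 0"
  proof -
    \<comment> \<open>Each term is regrouped around the convergent quantity
      \<open>p^2 * card E\<close>; the remaining powers of \<open>p\<close>, the factor
      \<open>1 / sqrt (card E)\<close> and the bias of the rate tend to 0.\<close>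
    let ?g = "\<lambda>n. ?P n * ((1 + c) / 2) * (1 / sqrt (?q n)) + \<bar>?P n * s - l\<bar>
      + 6 * ?p n * ?P n * (2 * s + c) + 16 * (?p n)\<^sup>2 * ?P n * c"
    have sq: "(\<lambda>n. 1 / sqrt (?q n)) \<longlonglongrightarrow> 0"
      by (intro tendsto_divide_0[OF tendsto_const] filterlim_at_top_imp_at_infinity
          filterlim_compose[OF sqrt_at_top P.card_edges_at_top])
    have "?g \<longlonglongrightarrow> 2 * \<gamma> * ((1 + c) / 2) * 0 + \<bar>2 * \<gamma> * s - l\<bar>
      + 6 * 0 * (2 * \<gamma>) * (2 * s + c) + 16 * 0\<^sup>2 * (2 * \<gamma>) * c"
      by (intro tendsto_add tendsto_mult tendsto_diff tendsto_rabs tendsto_power tendsto_const sq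
          P.mean_overlap_limit P.edge_density_limit)
    then have g: "?g \<longlonglongrightarrow> 0" by (simp add: l_def)
    have alg: "a * ((1 + c) * sqrt r / 2) = a * r * ((1 + c) / 2) * (1 / sqrt r)" if "r \<ge> 0" for a r
    proof -
      have "a * r * ((1 + c) / 2) * (1 / sqrt r) = a * ((1 + c) / 2) * (r / sqrt r)" by simp
      then show ?thesis unfolding real_div_sqrt[OF that] by simp
    qed
    have le: "\<forall>\<^sub>F n in sequentially. D n \<le> ?g n"
      using good
    proof eventually_elim
      case (elim n)
      have "D n \<le> (?p n)\<^sup>2 * ((1 + c) * sqrt (?q n) / 2) + \<bar>(?p n)\<^sup>2 * s * ?q n - l\<bar>
        + 6 * ?p n ^ 3 * ((2 * s + c) * ?q n) + 16 * ?p n ^ 4 * (c * ?q n)"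
        unfolding D_def using elim by (intro iid_factors.expectation_poisson_defect_le[OF iid]) auto
      also have "(?p n)\<^sup>2 * ((1 + c) * sqrt (?q n) / 2) = ?P n * ((1 + c) / 2) * (1 / sqrt (?q n))"
        by (rule alg) simp
      also have "(?p n)\<^sup>2 * s * ?q n = ?P n * s" by simp
      also have "6 * ?p n ^ 3 * ((2 * s + c) * ?q n) = 6 * ?p n * ?P n * (2 * s + c)"
        by (simp only: power3_eq_cube power2_eq_square mult_ac)
      also have "16 * ?p n ^ 4 * (c * ?q n) = 16 * (?p n)\<^sup>2 * ?P n * c"
        by (simp only: power4_eq_xxxx power2_eq_square mult_ac)
      finally show ?case .
    qed
    have "\<forall>\<^sub>F n in sequentially. 0 \<le> D n"
      using good
    proof eventually_elim
      case (elim n)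
      then show ?case unfolding D_def
        by (intro Bochner_Integration.integral_nonneg iid_factors.poisson_defect_nonneg[OF iid]) auto
    qed
    from tendsto_sandwich[OF this le tendsto_const g] show ?thesis .
  qed

  define J where "J n = exp (2 * (s - 1) * ?P n)" for n
  have J: "J \<longlonglongrightarrow> exp (2 * (s - 1) * (2 * \<gamma>))"
    unfolding J_def[abs_def] by (intro tendsto_exp tendsto_mult tendsto_const P.mean_overlap_limit)
  have I: "\<forall>\<^sub>F n in sequentially. I n \<le> J n"
    using good
  proof eventually_elim
    case (elim n)
    have "I n \<le> exp (2 * (?p n)\<^sup>2 * (s - 1) * ?q n)"
      unfolding I_def using elim by (intro iid_factors.expectation_inverse_prod_le[OF iid]) auto
    also have "2 * (?p n)\<^sup>2 * (s - 1) * ?q n = 2 * (s - 1) * ?P n"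
      by (simp only: mult_ac)
    finally show ?case by (simp only: J_def)
  qed

  have main: "converges_in_prob M (\<lambda>n x. measure_pmf.expectation (overlap_law (S n) \<beta> (\<lambda>e. \<omega> n e x)) f)
      (poisson_mean f l)" if f: "\<And>j. \<bar>f j\<bar> \<le> B" and B: "B > 0" for f B
  proof -
    let ?G = "\<lambda>n x. measure_pmf.expectation (overlap_law (S n) \<beta> (\<lambda>e. \<omega> n e x)) f"
    have meas: "?G n \<in> borel_measurable (M n)" if "n \<ge> 1" for n
      using that P.subgraphs P.nonempty P.finite_edges \<omega>_meas
      by (intro expectation_overlap_law_measurable[of "E n"]) auto
    \<comment> \<open>The identity holds only almost surely, since weights equal to
      \<open>- \<infinity>\<close> are excluded only up to null sets.\<close>
    have eq: "AE x in M n. above (E n) (uniform (S n)) (\<lambda>e. X n e x) {} \<noteq> 0 \<longrightarrow>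
      ?G n x = overlap_form (E n) (uniform (S n)) (\<lambda>e. X n e x) f
        / (above (E n) (uniform (S n)) (\<lambda>e. X n e x) {})\<^sup>2" if n: "n \<ge> 1" for n
    proof -
      have "AE x in M n. \<omega> n e x \<noteq> - \<infinity>" if e: "e \<in> E n" for e
        using W.not_minus_infinity \<omega>_meas[OF n e] unfolding W.ident[OF n e, symmetric]
        by (subst (asm) AE_distr_iff) auto
      then have "AE x in M n. \<forall>e\<in>E n. \<omega> n e x \<noteq> - \<infinity>"
        using P.finite_edges[OF n] by (simp add: AE_finite_all)
      then show ?thesis
      proof eventually_elim
        case (elim x)
        show ?case
          using elim P.subgraphs[OF n] P.card_subgraph[OF n]
          by (intro impI expectation_overlap_law_eq[OF P.finite_edges[OF n] _ P.nonempty[OF n] _ _ L[OF assms(3)]])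
             (auto simp: X_def)
      qed
    qed
    show ?thesis
      unfolding converges_in_prob_def
    proof (intro conjI allI impI)
      show "\<forall>\<^sub>F n in sequentially. ?G n \<in> borel_measurable (M n)"
        using eventually_ge_at_top[of 1] by eventually_elim (rule meas)
      fix \<epsilon> :: real assume \<epsilon>: "\<epsilon> > 0"
      \<comment> \<open>Small enough that the ratio error \<open>8 * B * \<eta>\<close> is at most
        \<epsilon>, and at most 1/2 as the ratio bound requires.\<close>
      define \<eta> where "\<eta> = min (1 / 2) (\<epsilon> / (8 * B))"
      have \<eta>: "0 < \<eta>" "\<eta> \<le> 1 / 2" using \<epsilon> B by (auto simp: \<eta>_def)
      have "\<eta> \<le> \<epsilon> / (8 * B)" by (simp add: \<eta>_def)
      then have \<eta>\<epsilon>: "8 * B * \<eta> \<le> \<epsilon>" using B by (simp add: field_simps)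
      show "(\<lambda>n. measure (M n) {x \<in> space (M n). \<bar>?G n x - poisson_mean f l\<bar> > \<epsilon>}) \<longlonglongrightarrow> 0"
      proof (rule tendsto_0_of_family)
        fix \<delta> :: real assume \<delta>: "\<delta> > 0"
        show "\<forall>\<^sub>F n in sequentially. measure (M n) {x \<in> space (M n). \<bar>?G n x - poisson_mean f l\<bar> > \<epsilon>}
            \<le> R n / (\<eta> * \<delta>\<^sup>2) + \<delta> * J n + D n / \<eta>"
          using good I
        proof eventually_elim
          case (elim n)
          then have n: "n \<ge> 1" by simp
          interpret iid_factors "M n" "E n" "X n" s c by (rule iid[OF n])
          note [measurable] = meas[OF n]
          have "prob {x \<in> space (M n). \<bar>?G n x - poisson_mean f l\<bar> > \<epsilon>}
              \<le> prob {x \<in> space (M n). \<bar>?G n x - poisson_mean f l\<bar> > 8 * B * \<eta>}"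
            using \<eta>\<epsilon> by (intro finite_measure_mono) (auto, measurable)
          also have "\<dots> \<le> R n / (\<eta> * \<delta>\<^sup>2) + \<delta> * I n + D n / \<eta>"
            unfolding R_def I_def D_def
            using elim l by (intro prob_overlap_ratio_le f \<eta> \<delta> meas[OF n] eq[OF n]) auto
          also have "\<dots> \<le> R n / (\<eta> * \<delta>\<^sup>2) + \<delta> * J n + D n / \<eta>"
            using elim \<delta> by (intro add_mono mult_left_mono) auto
          finally show ?case .
        qed
        \<comment> \<open>For fixed \<eta> and \<delta> both defects vanish in the limit. What
          remains is \<delta> times the limiting bound on the mean inverse partition function, and
          \<delta> is arbitrary.\<close>
        have "(\<lambda>n. R n / (\<eta> * \<delta>\<^sup>2) + \<delta> * J n + D n / \<eta>) \<longlonglongrightarrow>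
            0 / (\<eta> * \<delta>\<^sup>2) + \<delta> * exp (2 * (s - 1) * (2 * \<gamma>)) + 0 / \<eta>"
          using \<eta> \<delta> by (intro tendsto_add tendsto_divide tendsto_mult tendsto_const R D J) auto
        then show "(\<lambda>n. R n / (\<eta> * \<delta>\<^sup>2) + \<delta> * J n + D n / \<eta>) \<longlonglongrightarrow> \<delta> * exp (2 * (s - 1) * (2 * \<gamma>))"
          by simp
      qed simp
    qed
  qed
  show ?thesis
    unfolding weak_conv_in_prob_def rate
  proof (intro allI impI)
    fix f :: "nat \<Rightarrow> real" assume "continuous_on UNIV f \<and> bounded (range f)"
    then obtain B where B: "B > 0" "\<And>j. \<bar>f j\<bar> \<le> B" by (auto simp: bounded_pos)
    then have "measure_pmf.expectation (poisson_pmf l) f = poisson_mean f l"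
      using l by (intro expectation_poisson_pmf)
    then show "converges_in_prob M (\<lambda>n x. measure_pmf.expectation (overlap_law (S n) \<beta> (\<lambda>e. \<omega> n e x)) f)
        (measure_pmf.expectation (poisson_pmf l) f)"
      using main[OF B(2) B(1)] by simp
  qed
qed

end
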